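(* Let $r\ge1$ be an integer, $\nu$ fixed with $\Re(\nu)>-\frac1{r+1}$, $a<b$, $f,g\in C^\infty[a,b]$, with $g(a)=0$, $g^{(j)}(a)=0$ for $j=1,\dots,r$, $g^{(r+1)}(x)\ne0$ for all $x\in[a,b]$, and $g(x)\ne0$, $g'(x)\ne0$ for $x\in(a,b]$. Let $\mathcal{H}_\nu[h]=\int_a^bh(x)J_\nu(\omega g(x))\,dx$. Define $\widehat\varphi_k(x)=g'(x)g(x)^{\frac{k-r}{r+1}}$ if $g^{(r+1)}>0$ on $[a,b]$, and $\widehat\varphi_k(x)=g'(x)(-g(x))^{\frac{k-r}{r+1}}$ if $g^{(r+1)}<0$ on $[a,b]$. Let $a=x_0<\dots<x_d=b$ be distinct nodes with positive integer multiplicities $m_0,\dots,m_d$, $n=\sum m_k$, and let $\widehat p=\sum_{k=0}^{n-1}c_k\widehat\varphi_k$ be the unique function in the span of $\widehat\varphi_0,\dots,\widehat\varphi_{n-1}$ with $\widehat p^{(j-1)}(x_k)=f^{(j-1)}(x_k)$ for $j=1,\dots,m_k$, $k=0,\dots,d$. Let $Q^F[f]=\mathcal{H}_\nu[\widehat p]$. If $m\ge1$ is an integer with $m_d\ge m$ and $m_0\ge m(r+1)$, then $\mathcal{H}_\nu[f]-Q^F[f]=\mathcal{O}(\omega^{-m-\frac1{r+1}})$ as $\omega\to\infty$.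
   Context: $J_\nu$ is the Bessel function of the first kind of order $\nu$. The interpolant $\widehat p$ exists and is unique since the span of $\widehat\varphi_0,\dots,\widehat\varphi_{n-1}$ is an extended Chebyshev space. *)

theory Defs
  imports "HOL-Analysis.Analysis" "HOL-Library.Landau_Symbols"
begin

fun nderiv :: "nat \<Rightarrow> real set \<Rightarrow> (real \<Rightarrow> real) \<Rightarrow> real \<Rightarrow> real" where
  "nderiv 0 S h = h"
| "nderiv (Suc n) S h =
     (\<lambda>x. THE D. (nderiv n S h has_real_derivative D) (at x within S))"

definition smooth_on :: "real set \<Rightarrow> (real \<Rightarrow> real) \<Rightarrow> bool" where
  "smooth_on S h \<longleftrightarrow>
     (\<forall>n. \<forall>x\<in>S. (nderiv n S h has_real_derivative nderiv (Suc n) S h x) (at x within S))"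

definition besselJ :: "complex \<Rightarrow> complex \<Rightarrow> complex" where
  "besselJ \<nu> z = (z / 2) powr \<nu> *
     (\<Sum>k. (-1) ^ k * rGamma (of_nat k + \<nu> + 1) / of_nat (fact k) * (z / 2) ^ (2 * k))"

definition bessel_int :: "complex \<Rightarrow> real \<Rightarrow> real \<Rightarrow> (real \<Rightarrow> real) \<Rightarrow> (real \<Rightarrow> real) \<Rightarrow> real \<Rightarrow> complex" where
  "bessel_int \<nu> a b g h \<omega> =
     integral {a..b} (\<lambda>x. complex_of_real (h x) * besselJ \<nu> (complex_of_real (\<omega> * g x)))"

text \<open>The basis functions phi-hat_k (on (a,b]).\<close>
definition phihat :: "nat \<Rightarrow> real \<Rightarrow> real \<Rightarrow> (real \<Rightarrow> real) \<Rightarrow> nat \<Rightarrow> real \<Rightarrow> real" where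
  "phihat r a b g k x =
     (if \<forall>y\<in>{a..b}. nderiv (Suc r) {a..b} g y > 0
      then nderiv 1 {a..b} g x * (g x) powr ((real k - real r) / (real r + 1))
      else nderiv 1 {a..b} g x * (- g x) powr ((real k - real r) / (real r + 1)))"

end

(* On (a,b] write |g| = (x-a)^(r+1) G and |g'| = (x-a)^r G1 with G, G1 smooth up to a and bounded
   below; then phi-hat_k is (x-a)^k times a smooth function, so h = f - p-hat is smooth up to a and
   equals (x-a)^(m(r+1)) S with S smooth and vanishing to order m at b.  Since
   (g^(nu+1) J_(nu+1)(omega g))' = omega g' g^(nu+1) J_nu(omega g), each integration by parts gains
   a factor 1/omega, raises nu by one and lowers the order of vanishing at a by r+1 and at b by one.
   After m steps an integrand S J_(nu+m)(omega g) remains, whose integral is O(omega^(-1/(r+1))). *)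
theory Submission
  imports Defs
begin

section \<open>Bessel functions\<close>

text \<open>Each basis function has the value 0 at \<open>a\<close> (because
  \<open>0 powr y = 0\<close>), which need not be its limit there. Smoothness up to \<open>a\<close>
  is therefore expressed by bounds on all derivatives over (a, b], and the point \<open>a\<close> is
  discarded as a null set in the integrals. The delicate step is that dividing by (x-a)^N keeps
  these bounds: a quotient q = f/(x-a) solves the Euler equation (x-a) q' + q = f', and bounds for
  derivatives of f pass to q through this equation. Since the order is complex, only two facts about
  the size of Bessel functions enter: boundedness away from 0, obtained from an energy estimate, and
  the size s^(Re mu) near 0. The condition Re nu > -1/(r+1) is integrability of |g|^(Re nu) at
  \<open>a\<close>. The exponent 1/(r+1) comes from the scale delta with omega delta^(r+1) = 1. A
  negative g changes the integrals only by the constant factor exp(i pi nu).\<close>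

definition bessel_series :: "complex \<Rightarrow> complex \<Rightarrow> complex" where
  "bessel_series \<mu> w = (\<Sum>k. (-1) ^ k * rGamma (of_nat k + \<mu> + 1) / of_nat (fact k) * w ^ k)"

text \<open>By \<open>rGamma z = z * rGamma (z + 1)\<close> consecutive terms have ratio
  \<open>- w / (z * (k + 1))\<close> with \<open>z = k + \<mu> + 1\<close>. The reciprocal Gamma
  function is entire, so negative integer orders form no separate case.\<close>

lemma summable_bessel_series:
  fixes \<mu> w :: complex
  shows "summable (\<lambda>k. (-1) ^ k * rGamma (of_nat k + \<mu> + 1) / of_nat (fact k) * w ^ k)"
proof (rule summable_ratio_test)
  \<comment> \<open>This threshold forces \<open>cmod z\<close> to be at least
    \<open>2 * cmod w + 1\<close>, which makes the ratio at most 1/2.\<close>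
  let ?N = "nat \<lceil>cmod \<mu> + 2 * cmod w\<rceil> + 1"
  fix k assume k: "k \<ge> ?N"
  define z where "z = of_nat k + \<mu> + 1"
  have k': "real k \<ge> cmod \<mu> + 2 * cmod w" using k by linarith
  have "real k + 1 \<le> cmod z + cmod \<mu>"
    using norm_triangle_ineq[of z "- \<mu>"] norm_of_nat[of "Suc k", where ?'a=complex]
    by (simp add: z_def add.commute add.left_commute del: norm_of_nat)
  then have z: "cmod z \<ge> 2 * cmod w + 1" using k' by linarith
  then have z1: "cmod z \<ge> 1" using norm_ge_zero[of w] by linarith
  then have "z \<noteq> 0" by auto
  have "rGamma z = z * rGamma (z + 1)" by (rule rGamma_plus1[symmetric])
  then have r: "rGamma (of_nat (Suc k) + \<mu> + 1) = rGamma z / z"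
    using \<open>z \<noteq> 0\<close> by (simp add: z_def field_simps)
  have "cmod w / (cmod z * (real k + 1)) \<le> 1 / 2"
  proof -
    have "cmod z * 1 \<le> cmod z * (real k + 1)" by (intro mult_left_mono) auto
    then have "2 * cmod w \<le> cmod z * (real k + 1)" using z by linarith
    moreover have "cmod z * (real k + 1) > 0" using z1 by (intro mult_pos_pos) linarith+
    ultimately show ?thesis by (simp add: field_simps)
  qed
  then have "cmod w / (cmod z * (real k + 1)) * (cmod (rGamma z) / fact k * cmod w ^ k)
      \<le> 1 / 2 * (cmod (rGamma z) / fact k * cmod w ^ k)"
    by (intro mult_right_mono) auto
  moreover have "norm ((-1) ^ Suc k * rGamma (of_nat (Suc k) + \<mu> + 1) / of_nat (fact (Suc k)) * w ^ Suc k)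
     = cmod w / (cmod z * (real k + 1)) * (cmod (rGamma z) / fact k * cmod w ^ k)"
  proof -
    have "norm (complex_of_nat (fact (Suc k))) = (real k + 1) * fact k"
      unfolding norm_of_nat by (simp add: algebra_simps)
    then show ?thesis unfolding r norm_mult norm_divide norm_power
      by (simp add: mult_ac del: fact_Suc of_nat_fact)
  qed
  moreover have "norm ((-1) ^ k * rGamma (of_nat k + \<mu> + 1) / of_nat (fact k) * w ^ k)
     = cmod (rGamma z) / fact k * cmod w ^ k"
    by (simp add: z_def norm_mult norm_divide norm_power)
  ultimately show "norm ((-1) ^ Suc k * rGamma (of_nat (Suc k) + \<mu> + 1) / of_nat (fact (Suc k)) * w ^ Suc k)
    \<le> 1 / 2 * norm ((-1) ^ k * rGamma (of_nat k + \<mu> + 1) / of_nat (fact k) * w ^ k)" by metis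
qed simp

text \<open>The factor produced by termwise differentiation cancels against the factorial, and the
  index shift inside \<open>rGamma\<close> is an increase of the order by one.\<close>

lemma bessel_series_deriv: "(bessel_series \<mu> has_field_derivative - bessel_series (\<mu> + 1) w) (at w)"
proof -
  define c where "c k = (-1) ^ k * rGamma (of_nat k + \<mu> + 1) / of_nat (fact k)" for k
  have "DERIV (\<lambda>x. \<Sum>n. c n * x ^ n) w :> (\<Sum>n. diffs c n * w ^ n)"
    by (rule termdiffs_strong_converges_everywhere) (unfold c_def, rule summable_bessel_series)
  moreover have "diffs c n = - ((-1) ^ n * rGamma (of_nat n + (\<mu> + 1) + 1) / of_nat (fact n))" for n
  proof -
    define N where "N = complex_of_nat (Suc n)"
    have "N \<noteq> 0" unfolding N_def by (rule of_nat_neq_0)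
    moreover have "complex_of_nat (fact (Suc n)) = N * of_nat (fact n)"
      unfolding N_def fact_Suc of_nat_mult by simp
    moreover have "complex_of_nat (Suc n) + \<mu> + 1 = of_nat n + (\<mu> + 1) + 1" by simp
    ultimately show ?thesis unfolding diffs_def c_def N_def[symmetric] by simp
  qed
  ultimately have "DERIV (\<lambda>x. \<Sum>n. c n * x ^ n) w :>
     (\<Sum>n. - ((-1) ^ n * rGamma (of_nat n + (\<mu> + 1) + 1) / of_nat (fact n) * w ^ n))" by simp
  then show ?thesis unfolding suminf_minus[OF summable_bessel_series]
    by (simp add: c_def bessel_series_def[abs_def])
qed

text \<open>Write \<open>rGamma (k + \<mu> + 1)\<close> as
  \<open>(k + (\<mu> + 1)) * rGamma (k + \<mu> + 2)\<close>. The summand \<open>\<mu> + 1\<close>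
  yields the series of order \<open>\<mu> + 1\<close>; the summand \<open>k\<close> cancels against
  the factorial and shifts the index, yielding order \<open>\<mu> + 2\<close>.\<close>

lemma bessel_series_rec: "bessel_series \<mu> w = (\<mu> + 1) * bessel_series (\<mu> + 1) w - w * bessel_series (\<mu> + 2) w"
proof -
  define T where "T \<mu> k = (-1) ^ k * rGamma (of_nat k + \<mu> + 1) / of_nat (fact k) * w ^ k" for \<mu> k
  have sm: "T \<mu> sums bessel_series \<mu> w" for \<mu>
    unfolding T_def bessel_series_def by (rule summable_sums[OF summable_bessel_series])
  \<comment> \<open>The shifted series, padded with 0 in front so that it can be added to the other
    one term by term.\<close>
  define U where "U k = (case k of 0 \<Rightarrow> 0 | Suc j \<Rightarrow> - w * T (\<mu> + 2) j)" for k
  have "(\<lambda>j. U (Suc j)) sums (- w * bessel_series (\<mu> + 2) w)"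
    unfolding U_def nat.case using sums_mult[OF sm[of "\<mu> + 2"], of "- w"] by simp
  then have "U sums (- w * bessel_series (\<mu> + 2) w)"
    using sums_Suc[of U] by (simp add: U_def)
  then have "(\<lambda>k. (\<mu> + 1) * T (\<mu> + 1) k + U k) sums ((\<mu> + 1) * bessel_series (\<mu> + 1) w + - w * bessel_series (\<mu> + 2) w)"
    by (intro sums_add sums_mult sm)
  moreover have "(\<mu> + 1) * T (\<mu> + 1) k + U k = T \<mu> k" for k
  proof -
    have r: "rGamma (of_nat k + \<mu> + 1) = (of_nat k + \<mu> + 1) * rGamma (of_nat k + \<mu> + 2)"
      using rGamma_plus1[of "of_nat k + \<mu> + 1"] by (simp add: algebra_simps)
    show ?thesis
    proof (cases k)
      case 0 then show ?thesis using r by (simp add: U_def T_def algebra_simps)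
    next
      case (Suc j)
      define N where "N = complex_of_nat k"
      define R where "R = rGamma (N + \<mu> + 2)"
      have "N \<noteq> 0" unfolding N_def Suc by (rule of_nat_neq_0)
      have f: "complex_of_nat (fact k) = N * of_nat (fact j)"
        unfolding N_def Suc fact_Suc of_nat_mult by simp
      have g: "rGamma (N + (\<mu> + 1) + 1) = R" "rGamma (of_nat j + (\<mu> + 2) + 1) = R"
        unfolding R_def N_def Suc by (simp_all add: add_ac)
      have U: "U k = - w * ((-1) ^ j * R / of_nat (fact j) * w ^ j)"
        unfolding U_def Suc nat.case T_def g ..
      have p: "(-1) ^ k = - ((-1 :: complex) ^ j)" "w ^ k = w * w ^ j" by (simp_all add: Suc)
      have r': "rGamma (N + \<mu> + 1) = (N + \<mu> + 1) * R" using r by (simp add: N_def R_def)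
      show ?thesis unfolding U unfolding T_def f p N_def[symmetric] g r'
        using \<open>N \<noteq> 0\<close> by (simp add: field_simps)
    qed
  qed
  ultimately have "T \<mu> sums ((\<mu> + 1) * bessel_series (\<mu> + 1) w + - w * bessel_series (\<mu> + 2) w)" by simp
  then show ?thesis using sums_unique2[OF sm[of \<mu>]] by simp
qed

text \<open>Separates the branch behaviour, which sits in the power, from an entire function of
  \<open>(z / 2)\<^sup>2\<close>.\<close>

lemma besselJ_eq: "besselJ \<mu> z = (z / 2) powr \<mu> * bessel_series \<mu> ((z / 2)\<^sup>2)"
  unfolding besselJ_def bessel_series_def by (simp add: power_mult)

lemma powr_plus1: "s > 0 \<Longrightarrow> (complex_of_real s / 2) powr (\<mu> + 1) = (complex_of_real s / 2) powr \<mu> * (s / 2)"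
  by (simp add: powr_add)

text \<open>The classical relation between three consecutive orders, used to trade order
  \<open>\<mu> + 2\<close> for order \<open>\<mu>\<close> in a derivative.\<close>

lemma besselJ_rec:
  assumes "s > 0"
  shows "besselJ \<mu> (of_real s) = 2 * (\<mu> + 1) / s * besselJ (\<mu> + 1) (of_real s) - besselJ (\<mu> + 2) (of_real s)"
proof -
  have p2: "(complex_of_real s / 2) powr (\<mu> + 2) = (complex_of_real s / 2) powr \<mu> * (s / 2) * (s / 2)"
    using powr_plus1[OF assms, of "\<mu> + 1"] unfolding powr_plus1[OF assms, of \<mu>] by (simp add: add.assoc)
  show ?thesis
    unfolding besselJ_eq powr_plus1[OF assms] p2 bessel_series_rec[of \<mu>] using assms
    by (simp add: field_simps power2_eq_square)
qed

text \<open>In the product of power and series, the power contributes \<open>\<mu> / s\<close>; the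
  series contributes order \<open>\<mu> + 1\<close>, whose missing factor \<open>s / 2\<close> is
  supplied by the chain rule.\<close>

lemma besselJ_deriv1:
  assumes s: "s > 0"
  shows "((\<lambda>t. besselJ \<mu> (of_real t)) has_vector_derivative
          (\<mu> / s * besselJ \<mu> (of_real s) - besselJ (\<mu> + 1) (of_real s))) (at s within A)"
proof -
  have "(besselJ \<mu> has_field_derivative
       (\<mu> / s * besselJ \<mu> (of_real s) - besselJ (\<mu> + 1) (of_real s))) (at (of_real s))"
    unfolding besselJ_eq powr_plus1[OF s]
  proof -
    let ?z = "complex_of_real s"
    have n: "?z / 2 \<notin> \<real>\<^sub>\<le>\<^sub>0" using s by (simp add: complex_nonpos_Reals_iff)
    have 1: "((\<lambda>z. (z / 2) powr \<mu>) has_field_derivative \<mu> * (?z / 2) powr (\<mu> - 1) * (1 / 2)) (at ?z)"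
      by (rule DERIV_chain2[where f = "\<lambda>w. w powr \<mu>" and g = "\<lambda>z. z / 2", OF has_field_derivative_powr[OF n]]) (auto intro!: derivative_eq_intros)
    have 2: "((\<lambda>z. bessel_series \<mu> ((z / 2)\<^sup>2)) has_field_derivative - bessel_series (\<mu> + 1) ((?z / 2)\<^sup>2) * (?z / 2)) (at ?z)"
      by (rule DERIV_chain2[OF bessel_series_deriv]) (auto intro!: derivative_eq_intros)
    show "((\<lambda>z. (z / 2) powr \<mu> * bessel_series \<mu> ((z / 2)\<^sup>2)) has_field_derivative
        \<mu> / ?z * ((?z / 2) powr \<mu> * bessel_series \<mu> ((?z / 2)\<^sup>2)) -
        (?z / 2) powr \<mu> * of_real (s / 2) * bessel_series (\<mu> + 1) ((?z / 2)\<^sup>2)) (at ?z)"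
      by (rule DERIV_cong[OF DERIV_mult[OF 1 2]])
        (use s in \<open>simp add: powr_diff field_simps\<close>)
  qed
  then show ?thesis
    by (rule has_vector_derivative_real_field)
qed

text \<open>The identity (s^(mu+1) J_(mu+1))' = s^(mu+1) J_mu, solved for the derivative of the
  Bessel function alone. The free set \<open>A\<close> serves the chain rule within (a, b].\<close>

lemma besselJ_deriv2:
  assumes s: "s > 0"
  shows "((\<lambda>t. besselJ (\<mu> + 1) (of_real t)) has_vector_derivative
          (besselJ \<mu> (of_real s) - (\<mu> + 1) / s * besselJ (\<mu> + 1) (of_real s))) (at s within A)"
proof -
  have "besselJ \<mu> (of_real s) - (\<mu> + 1) / s * besselJ (\<mu> + 1) (of_real s)
      = (\<mu> + 1) / s * besselJ (\<mu> + 1) (of_real s) - besselJ (\<mu> + 1 + 1) (of_real s)"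
    unfolding besselJ_rec[OF s, of \<mu>] using s by (simp add: field_simps add.assoc)
  then show ?thesis using besselJ_deriv1[OF s, of "\<mu> + 1" A] by simp
qed

text \<open>For \<open>y = J\<^sub>\<mu>\<close> the Bessel equation gives \<open>E' \<le> \<bar>\<mu>\<bar>\<^sup>2 / s\<^sup>2 * E\<close> for the energy
  \<open>E = \<bar>y\<bar>\<^sup>2 + \<bar>y'\<bar>\<^sup>2\<close>, so \<open>E * exp (\<bar>\<mu>\<bar>\<^sup>2 / s)\<close> decreases.\<close>
lemma besselJ_bounded:
  assumes c: "c > 0"
  obtains C where "\<And>s. s \<ge> c \<Longrightarrow> norm (besselJ \<mu> (of_real s)) \<le> C"
proof -
  define y where "y s = besselJ \<mu> (of_real s)" for s :: real
  define z where "z s = \<mu> / s * y s - besselJ (\<mu> + 1) (of_real s)" for s :: real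
  define E where "E s = y s \<bullet> y s + z s \<bullet> z s" for s
  define K where "K = (cmod \<mu>)\<^sup>2"
  have dy: "(y has_vector_derivative z s) (at s)" if "s > 0" for s
    unfolding y_def z_def using besselJ_deriv1[OF that] by blast
  \<comment> \<open>\<open>z\<close> is y', so this is Bessel's equation; it results from
    differentiating \<open>z\<close> and eliminating order \<open>\<mu> + 1\<close> in favour of
    \<open>y\<close> and \<open>z\<close>.\<close>
  have dz: "(z has_vector_derivative (- z s / s - y s + \<mu>\<^sup>2 / s\<^sup>2 * y s)) (at s)" if "s > 0" for s
  proof -
    have i: "((\<lambda>t. \<mu> / complex_of_real t) has_vector_derivative (- \<mu> / s\<^sup>2)) (at s)"
      apply (rule has_vector_derivative_real_field)
      apply (rule derivative_eq_intros refl | use that in force)+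
      using that by (simp add: power2_eq_square)
    show ?thesis unfolding z_def
      apply (rule derivative_eq_intros i dy besselJ_deriv2 that refl)+
      using that by (simp add: z_def y_def field_simps power2_eq_square)
  qed
  have dE: "(E has_real_derivative (2 * (y s \<bullet> z s) + 2 * (z s \<bullet> (- z s / s - y s + \<mu>\<^sup>2 / s\<^sup>2 * y s)))) (at s)"
    if "s > 0" for s
    unfolding E_def has_real_derivative_iff_has_vector_derivative
    apply (rule derivative_eq_intros bounded_bilinear.has_vector_derivative[OF bounded_bilinear_inner] dy[OF that] dz[OF that])+
    by (simp add: inner_commute)
  \<comment> \<open>The two products of \<open>y\<close> and \<open>z\<close> cancel and the
    friction term \<open>- z s / s\<close> only lowers the energy. What survives is the term with
    \<open>\<mu>\<^sup>2 / s\<^sup>2\<close>, bounded by Cauchy-Schwarz and 2 |y| |z| <= E.\<close>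
  have le: "2 * (y s \<bullet> z s) + 2 * (z s \<bullet> (- z s / s - y s + \<mu>\<^sup>2 / s\<^sup>2 * y s)) \<le> K / s\<^sup>2 * E s" if "s > 0" for s
  proof -
    have e: "- z s / s = (- (1 / s)) *\<^sub>R z s" by (simp add: scaleR_conv_of_real)
    have "z s \<bullet> (- z s / s) = - (1 / s) * (z s \<bullet> z s)" unfolding e by simp
    then have 1: "z s \<bullet> (- z s / s) \<le> 0" using that by simp
    have "z s \<bullet> (\<mu>\<^sup>2 / s\<^sup>2 * y s) \<le> norm (z s) * norm (\<mu>\<^sup>2 / s\<^sup>2 * y s)" by (rule norm_cauchy_schwarz)
    also have "\<dots> = K / s\<^sup>2 * (norm (z s) * norm (y s))"
      by (simp add: K_def norm_mult norm_divide norm_power)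
    finally have "z s \<bullet> (\<mu>\<^sup>2 / s\<^sup>2 * y s) \<le> K / s\<^sup>2 * (norm (z s) * norm (y s))" .
    then have 2: "2 * (z s \<bullet> (\<mu>\<^sup>2 / s\<^sup>2 * y s)) \<le> K / s\<^sup>2 * (2 * norm (z s) * norm (y s))"
      by (metis (no_types, opaque_lifting) mult.assoc mult.left_commute mult_left_mono zero_le_numeral)
    have "2 * norm (z s) * norm (y s) \<le> E s"
      unfolding E_def dot_square_norm using sum_squares_bound[of "norm (z s)" "norm (y s)"] by simp
    then have "K / s\<^sup>2 * (2 * norm (z s) * norm (y s)) \<le> K / s\<^sup>2 * E s"
      by (intro mult_left_mono) (auto simp: K_def)
    then have "2 * (z s \<bullet> (\<mu>\<^sup>2 / s\<^sup>2 * y s)) \<le> K / s\<^sup>2 * E s" using 2 by linarith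
    then show ?thesis using 1 unfolding inner_add_right inner_diff_right
      by (simp add: inner_commute[of "y s"])
  qed
  have dec: "E s * exp (K / s) \<le> E c * exp (K / c)" if "s \<ge> c" for s
  proof (rule DERIV_nonpos_imp_nonincreasing[OF that])
    fix x assume "c \<le> x" "x \<le> s"
    then have x: "x > 0" using c by simp
    let ?E = "2 * (y x \<bullet> z x) + 2 * (z x \<bullet> (- z x / x - y x + \<mu>\<^sup>2 / x\<^sup>2 * y x))"
    have "((\<lambda>s. E s * exp (K / s)) has_real_derivative ((?E - K / x\<^sup>2 * E x) * exp (K / x))) (at x)"
      apply (rule derivative_eq_intros dE[OF x] refl | use x in force)+
      by (simp add: algebra_simps power2_eq_square)
    moreover have "(?E - K / x\<^sup>2 * E x) * exp (K / x) \<le> 0"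
      using le[OF x] by (intro mult_nonpos_nonneg) auto
    ultimately show "\<exists>y. ((\<lambda>s. E s * exp (K / s)) has_real_derivative y) (at x) \<and> y \<le> 0" by blast
  qed
  show thesis
  proof
    fix s assume s: "s \<ge> c"
    have "(norm (y s))\<^sup>2 \<le> E s" unfolding E_def dot_square_norm by simp
    also have "\<dots> \<le> E s * exp (K / s)"
      using s c by (intro mult_right_mono[of 1 "exp _" "E s", simplified mult.commute mult_1_left] mult_le_cancel_left1[THEN iffD2])
        (auto simp: E_def K_def dot_square_norm)
    also have "\<dots> \<le> E c * exp (K / c)" by (rule dec[OF s])
    finally show "norm (besselJ \<mu> (of_real s)) \<le> sqrt (E c * exp (K / c))"
      by (simp add: y_def real_le_rsqrt)
  qed
qed

text \<open>By compactness the series factor is bounded on bounded sets, and for positive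
  \<open>s\<close> the power has modulus (s/2)^(Re mu). The real part may be negative, so this
  describes a singularity as well.\<close>

lemma besselJ_small:
  obtains C where "C \<ge> 0" "\<And>s. 0 < s \<Longrightarrow> s \<le> M \<Longrightarrow> norm (besselJ \<mu> (of_real s)) \<le> C * s powr (Re \<mu>)"
proof -
  have "continuous_on (cball 0 ((M / 2)\<^sup>2)) (bessel_series \<mu>)"
    by (rule continuous_at_imp_continuous_on) (auto intro: DERIV_isCont bessel_series_deriv)
  then have "bounded (bessel_series \<mu> ` cball 0 ((M / 2)\<^sup>2))"
    by (intro compact_imp_bounded compact_continuous_image) auto
  then obtain B where B: "\<And>w. norm w \<le> (M / 2)\<^sup>2 \<Longrightarrow> norm (bessel_series \<mu> w) \<le> B"
    unfolding bounded_iff by (metis (no_types, lifting) image_eqI mem_cball_0)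
  have "B \<ge> 0" using B[of 0] norm_ge_zero[of "bessel_series \<mu> 0"] by (metis norm_zero order_trans zero_le_power2)
  show thesis
  proof
    show "B * (1 / 2) powr (Re \<mu>) \<ge> 0" using \<open>B \<ge> 0\<close> by simp
    fix s :: real assume s: "0 < s" "s \<le> M"
    have "norm ((complex_of_real s / 2)\<^sup>2) = (s / 2)\<^sup>2" using s by (simp add: norm_power)
    also have "\<dots> \<le> (M / 2)\<^sup>2" using s by (intro power_mono) auto
    finally have 1: "norm (bessel_series \<mu> ((complex_of_real s / 2)\<^sup>2)) \<le> B" by (rule B)
    have "norm ((complex_of_real (s / 2)) powr \<mu>) = (s / 2) powr Re \<mu>"
      using s by (subst norm_powr_real_powr) auto
    also have "\<dots> = (1 / 2) powr Re \<mu> * s powr Re \<mu>" using s by (simp flip: powr_mult)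
    finally have 2: "norm ((complex_of_real s / 2) powr \<mu>) = (1 / 2) powr Re \<mu> * s powr Re \<mu>" by simp
    show "norm (besselJ \<mu> (of_real s)) \<le> B * (1 / 2) powr (Re \<mu>) * s powr (Re \<mu>)"
      unfolding besselJ_eq norm_mult 2 using mult_left_mono[OF 1, of "(1 / 2) powr Re \<mu> * s powr Re \<mu>"]
      by (simp add: mult_ac)
  qed
qed

text \<open>The series is even in its argument, so only the power changes; on the principal branch
  the logarithm of a negative real gains i pi. At 0 both sides vanish since
  \<open>0 powr \<mu> = 0\<close>.\<close>

lemma besselJ_minus:
  assumes "s \<ge> 0"
  shows "besselJ \<mu> (of_real (- s)) = exp (\<i> * pi * \<mu>) * besselJ \<mu> (of_real s)"
proof (cases "s = 0")
  case False
  then have "s > 0" using assms by simp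
  then have "(- complex_of_real s / 2) powr \<mu> = exp (\<i> * pi * \<mu>) * (complex_of_real s / 2) powr \<mu>"
    using Ln_of_real[of "s / 2"] Ln_minus[of "of_real (s / 2)"]
    by (simp add: powr_def exp_add[symmetric] algebra_simps)
  then show ?thesis by (simp add: besselJ_eq)
qed (simp add: besselJ_eq)

section \<open>Functions on \<open>(a, b]\<close> with bounded derivatives\<close>

lemma has_vector_derivative_mult_field:
  fixes f g :: "real \<Rightarrow> 'a::real_normed_field"
  assumes "(f has_vector_derivative f') (at x within S)" "(g has_vector_derivative g') (at x within S)"
  shows "((\<lambda>x. f x * g x) has_vector_derivative (f' * g x + f x * g')) (at x within S)"
  using has_vector_derivative_mult[OF assms] by (simp add: add.commute)

lemma tendsto_zero_bound:
  fixes f :: "real \<Rightarrow> 'a::real_normed_vector"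
  assumes "a < b" "\<And>x. x \<in> {a<..b} \<Longrightarrow> norm (f x) \<le> C * (x - a) powr p" "p > 0"
  shows "(f \<longlongrightarrow> 0) (at_right a)"
proof (rule Lim_null_comparison)
  show "\<forall>\<^sub>F x in at_right a. norm (f x) \<le> C * (x - a) powr p"
    using eventually_at_right_less[of a] eventually_at_right[of a b] assms(1)
    by (auto simp: eventually_at_right[OF assms(1)] intro!: exI[of _ b] assms(2))
  have "((\<lambda>x. (x - a) powr p) \<longlongrightarrow> 0) (at_right a)"
    by (rule tendsto_zero_powrI)
      (auto intro!: tendsto_eq_intros \<open>p > 0\<close> eventually_at_rightI[of a b] assms(1))
  then show "((\<lambda>x. C * (x - a) powr p) \<longlongrightarrow> 0) (at_right a)"
    by (rule tendsto_mult_right_zero)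
qed

text \<open>The left endpoint is left out because \<open>phihat\<close> raises g to negative powers
  there; the right endpoint stays in, since derivatives at \<open>b\<close> are
  interpolated.\<close>

locale half_open =
  fixes a b :: real
  assumes ab: "a < b"
begin

abbreviation I :: "real set" where "I \<equiv> {a<..b}"

definition vd :: "(real \<Rightarrow> 'a::real_normed_field) \<Rightarrow> real \<Rightarrow> 'a" where
  "vd f x = vector_derivative f (at x within I)"

primrec Bd :: "nat \<Rightarrow> (real \<Rightarrow> 'a::real_normed_field) \<Rightarrow> bool" where
  "Bd 0 f \<longleftrightarrow> (\<exists>C. \<forall>x\<in>I. norm (f x) \<le> C)"
| "Bd (Suc n) f \<longleftrightarrow> (\<exists>C. \<forall>x\<in>I. norm (f x) \<le> C) \<and>
     (\<forall>x\<in>I. (f has_vector_derivative vd f x) (at x within I)) \<and> Bd n (vd f)"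

text \<open>Stands for smoothness up to \<open>a\<close>: a function with bounded derivative is
  Lipschitz on (a, b], so every derivative has a limit at \<open>a\<close>. No value at
  \<open>a\<close> is ever consulted.\<close>

definition bsmooth :: "(real \<Rightarrow> 'a::real_normed_field) \<Rightarrow> bool" where
  "bsmooth f \<longleftrightarrow> (\<forall>n. Bd n f)"

lemma I_not_bot: "x \<in> I \<Longrightarrow> at x within I \<noteq> bot"
  using islimpt_subset[OF islimpt_greaterThanLessThan2, of a x I] by (auto simp: trivial_limit_within)

lemma vdI: "(f has_vector_derivative f') (at x within I) \<Longrightarrow> x \<in> I \<Longrightarrow> vd f x = f'"
  unfolding vd_def by (rule vector_derivative_within[OF I_not_bot])

lemma has_vd_cong:
  assumes "\<And>x. x \<in> I \<Longrightarrow> f x = g x" "x \<in> I"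
  shows "(f has_vector_derivative D) (at x within I) \<longleftrightarrow> (g has_vector_derivative D) (at x within I)"
  by (rule has_vector_derivative_cong_ev) (use assms in \<open>auto simp: eventually_at_filter\<close>)

lemma vd_cong: "(\<And>x. x \<in> I \<Longrightarrow> f x = g x) \<Longrightarrow> x \<in> I \<Longrightarrow> vd f x = vd g x"
  unfolding vd_def vector_derivative_def using has_vd_cong[of f g x] by auto

lemma Bd_congD: "Bd n f \<Longrightarrow> (\<And>x. x \<in> I \<Longrightarrow> f x = g x) \<Longrightarrow> Bd n g"
proof (induction n arbitrary: f g)
  case (Suc n)
  have "Bd n (vd g)"
    by (rule Suc.IH[of "vd f"]) (use Suc.prems vd_cong[of f g] in auto)
  moreover have "(g has_vector_derivative vd g x) (at x within I)" if "x \<in> I" for x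
  proof -
    have "(f has_vector_derivative vd g x) (at x within I)"
    proof (subst vd_cong[symmetric])
      show "(f has_vector_derivative vd f x) (at x within I)" using Suc.prems(1) that by simp
    qed (use Suc.prems(2) that in auto)
    then show ?thesis by (subst (asm) has_vd_cong[OF Suc.prems(2) that])
  qed
  ultimately show ?case using Suc.prems by simp
qed simp

lemma Bd_cong: "(\<And>x. x \<in> I \<Longrightarrow> f x = g x) \<Longrightarrow> Bd n f \<longleftrightarrow> Bd n g"
  using Bd_congD[of n f g] Bd_congD[of n g f] by fastforce

lemma Bd_bounded: "Bd n f \<Longrightarrow> \<exists>C. \<forall>x\<in>I. norm (f x) \<le> C"
  by (cases n) auto

lemma Bd_SucI:
  assumes "\<exists>C. \<forall>x\<in>I. norm (f x) \<le> C" "\<And>x. x \<in> I \<Longrightarrow> (f has_vector_derivative f' x) (at x within I)" "Bd n f'"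
  shows "Bd (Suc n) f"
proof -
  have e: "vd f x = f' x" if "x \<in> I" for x using vdI[OF assms(2) that] that by simp
  then show ?thesis using assms Bd_congD[OF assms(3), of "vd f"] by simp
qed

lemma Bd_antimono: "Bd (Suc n) f \<Longrightarrow> Bd n f"
proof (induction n arbitrary: f)
  case (Suc n)
  have "Bd n (vd f)" by (rule Suc.IH) (use Suc.prems in simp)
  then show ?case using Suc.prems by simp
qed simp

lemma Bd_const: "Bd n (\<lambda>x. c)"
proof (induction n arbitrary: c)
  case (Suc n)
  show ?case by (rule Bd_SucI[where f' = "\<lambda>_. 0"]) (auto intro: Suc)
qed auto

lemma Bd_add:
  "Bd n f \<Longrightarrow> Bd n g \<Longrightarrow> Bd n (\<lambda>x. f x + g x)"
proof (induction n arbitrary: f g)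
  case 0
  then obtain C D where "\<forall>x\<in>I. norm (f x) \<le> C" "\<forall>x\<in>I. norm (g x) \<le> D" by auto
  then show ?case by (auto intro!: exI[of _ "C + D"] norm_triangle_mono)
next
  case (Suc n)
  obtain C D where "\<forall>x\<in>I. norm (f x) \<le> C" "\<forall>x\<in>I. norm (g x) \<le> D" using Suc.prems by auto
  then have "\<exists>C. \<forall>x\<in>I. norm (f x + g x) \<le> C" by (auto intro!: exI[of _ "C + D"] norm_triangle_mono)
  then show ?case
    by (rule Bd_SucI[where f' = "\<lambda>x. vd f x + vd g x"]) (use Suc in \<open>auto intro: has_vector_derivative_add\<close>)
qed

lemma bounded_mult:
  assumes "\<exists>C. \<forall>x\<in>I. norm (f x) \<le> C" "\<exists>C. \<forall>x\<in>I. norm (g x) \<le> C"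
  shows "\<exists>C. \<forall>x\<in>I. norm (f x * g x :: 'a::real_normed_field) \<le> C"
proof -
  obtain C D where C: "\<forall>x\<in>I. norm (f x) \<le> C" and D: "\<forall>x\<in>I. norm (g x) \<le> D" using assms by auto
  have "norm (f x * g x) \<le> C * D" if x: "x \<in> I" for x
    unfolding norm_mult using C D x by (intro mult_mono') auto
  then show ?thesis by blast
qed

lemma Bd_mult:
  "Bd n f \<Longrightarrow> Bd n g \<Longrightarrow> Bd n (\<lambda>x. f x * g x)"
proof (induction n arbitrary: f g)
  case 0
  then show ?case using bounded_mult[of f g] by simp
next
  case (Suc n)
  show ?case
  proof (rule Bd_SucI[where f' = "\<lambda>x. vd f x * g x + f x * vd g x"])
    show "\<exists>C. \<forall>x\<in>I. norm (f x * g x) \<le> C" using bounded_mult[of f g] Suc.prems by simp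
    show "Bd n (\<lambda>x. vd f x * g x + f x * vd g x)"
      using Suc.prems Suc.prems[THEN Bd_antimono] by (intro Bd_add Suc.IH) auto
  qed (use Suc.prems in \<open>auto intro!: has_vector_derivative_mult_field\<close>)
qed

lemma Bd_ident: "Bd n (\<lambda>x. x)"
proof (cases n)
  case 0
  then show ?thesis by (auto intro!: exI[of _ "\<bar>a\<bar> + \<bar>b\<bar>"])
next
  case (Suc k)
  have "Bd (Suc k) (\<lambda>x. x)"
    by (rule Bd_SucI[where f' = "\<lambda>_. 1"]) (auto intro!: Bd_const exI[of _ "\<bar>a\<bar> + \<bar>b\<bar>"])
  then show ?thesis using Suc by simp
qed

text \<open>The lower bound is uniform because mere positivity on (a, b] would permit blow-up at
  \<open>a\<close>. The derivative is a product containing the inverse itself, which the induction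
  supplies at one order less.\<close>

lemma Bd_inverse:
  fixes f :: "real \<Rightarrow> real"
  assumes "c > 0" "\<And>x. x \<in> I \<Longrightarrow> f x \<ge> c"
  shows "Bd n f \<Longrightarrow> Bd n (\<lambda>x. inverse (f x))"
proof (induction n)
  case 0
  have pos: "f x > 0" if "x \<in> I" for x using assms(1) assms(2)[OF that] by simp
  show ?case unfolding Bd.simps
  proof (intro exI ballI)
    fix x assume x: "x \<in> I"
    show "norm (inverse (f x)) \<le> inverse c"
      using le_imp_inverse_le[OF assms(2)[OF x] assms(1)] pos[OF x] by (simp add: abs_of_pos)
  qed
next
  case (Suc n)
  have pos: "f x > 0" if "x \<in> I" for x using assms(1) assms(2)[OF that] by simp
  have bd: "\<exists>C. \<forall>x\<in>I. norm (inverse (f x)) \<le> C"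
  proof (intro exI ballI)
    fix x assume x: "x \<in> I"
    show "norm (inverse (f x)) \<le> inverse c"
      using le_imp_inverse_le[OF assms(2)[OF x] assms(1)] pos[OF x] by (simp add: abs_of_pos)
  qed
  have "Bd n (\<lambda>x. inverse (f x))" by (rule Suc.IH[OF Bd_antimono[OF Suc.prems]])
  then have "Bd n (\<lambda>x. (- 1) * (inverse (f x) * vd f x * inverse (f x)))"
    using Suc.prems by (intro Bd_mult Bd_const) auto
  then show ?case
  proof (rule Bd_SucI[OF bd, rotated])
    fix x assume x: "x \<in> I"
    have "(f has_real_derivative vd f x) (at x within I)"
      using Suc.prems x by (simp add: has_real_derivative_iff_has_vector_derivative)
    then show "((\<lambda>x. inverse (f x)) has_vector_derivative (- 1) * (inverse (f x) * vd f x * inverse (f x))) (at x within I)"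
      using DERIV_inverse'[of f "vd f x" x I] pos[OF x]
      by (simp add: has_real_derivative_iff_has_vector_derivative)
  qed
qed

lemma Bd_powr:
  fixes f :: "real \<Rightarrow> real"
  assumes "c > 0" "\<And>x. x \<in> I \<Longrightarrow> f x \<ge> c"
  shows "Bd n f \<Longrightarrow> Bd n (\<lambda>x. f x powr p)"
proof (induction n)
  case (Suc n)
  have pos: "f x > 0" if "x \<in> I" for x using assms(1) assms(2)[OF that] by simp
  obtain C where C: "\<forall>x\<in>I. norm (f x) \<le> C" using Suc.prems by auto
  have bd: "\<exists>C. \<forall>x\<in>I. norm (f x powr p) \<le> C"
  proof (intro exI ballI)
    fix x assume x: "x \<in> I"
    have "f x \<le> C" "c \<le> f x" "0 < f x" using C x assms pos by (auto simp: abs_le_iff)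
    \<comment> \<open>For \<open>p \<ge> 0\<close> the value at the upper bound \<open>C\<close>
      dominates, otherwise the value at the lower bound \<open>c\<close>; the sum serves
      both.\<close>
    then show "norm (f x powr p) \<le> c powr p + C powr p"
      using powr_mono2[of p "f x" C] powr_mono2'[of p c "f x"] assms(1)
      by (cases "p \<ge> 0") (auto intro: add_increasing add_increasing2)
  qed
  have "Bd n (\<lambda>x. f x powr p)" by (rule Suc.IH[OF Bd_antimono[OF Suc.prems]])
  then have "Bd n (\<lambda>x. p * (f x powr p * inverse (f x) * vd f x))"
    using Suc.prems Bd_antimono[OF Suc.prems] Bd_inverse[OF assms] by (intro Bd_mult Bd_const) auto
  then show ?case
  proof (rule Bd_SucI[OF bd, rotated])
    fix x assume x: "x \<in> I"
    have "(f has_real_derivative vd f x) (at x within I)"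
      using Suc.prems x by (simp add: has_real_derivative_iff_has_vector_derivative)
    from DERIV_chain2[OF has_real_derivative_powr[OF pos[OF x]] this]
    show "((\<lambda>x. f x powr p) has_vector_derivative p * (f x powr p * inverse (f x) * vd f x)) (at x within I)"
      using pos[OF x]
      by (simp add: has_real_derivative_iff_has_vector_derivative powr_diff field_simps)
  qed
next
  case 0
  then obtain C where C: "\<forall>x\<in>I. norm (f x) \<le> C" by auto
  have pos: "f x > 0" if "x \<in> I" for x using assms(1) assms(2)[OF that] by simp
  show ?case unfolding Bd.simps
  proof (intro exI ballI)
    fix x assume x: "x \<in> I"
    have "f x \<le> C" "c \<le> f x" "0 < f x" using C x assms pos by (auto simp: abs_le_iff)
    then show "norm (f x powr p) \<le> c powr p + C powr p"
      using powr_mono2[of p "f x" C] powr_mono2'[of p c "f x"] assms(1)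
      by (cases "p \<ge> 0") (auto intro: add_increasing add_increasing2)
  qed
qed

lemma Bd_of_real:
  "Bd n f \<Longrightarrow> Bd n (\<lambda>x. of_real (f x) :: 'a::real_normed_field)"
proof (induction n arbitrary: f)
  case (Suc n)
  then show ?case
    by (intro Bd_SucI[where f' = "\<lambda>x. of_real (vd f x)"])
      (auto intro!: has_vector_derivative_of_real simp: has_real_derivative_iff_has_vector_derivative)
qed auto

text \<open>The product with \<open>(x - a) ^ (k + 1)\<close> has the derivative \<open>(x - a) ^ k * f\<close>, so the mean value
  theorem bounds \<open>u\<close> by \<open>f\<close>, and differentiating the equation raises \<open>k\<close> by one.\<close>
lemma Bd_euler_ode:
  fixes f u u' :: "real \<Rightarrow> 'a::real_normed_field"
  assumes "Bd n f" "\<exists>C. \<forall>x\<in>I. norm (u x) \<le> C"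
    "\<And>x. x \<in> I \<Longrightarrow> (u has_vector_derivative u' x) (at x within I)"
    "\<And>x. x \<in> I \<Longrightarrow> of_real (x - a) * u' x + of_nat (k + 1) * u x = f x"
  shows "Bd n u"
  using assms
proof (induction n arbitrary: f u u' k)
  case (Suc n)
  have nz: "of_real (x - a) \<noteq> (0 :: 'a)" if "x \<in> I" for x using that by auto
  let ?u' = "\<lambda>x. inverse (of_real (x - a)) * (f x - of_nat (k + 1) * u x)"
  let ?u'' = "\<lambda>x. inverse (of_real (x - a)) * (vd f x - of_nat (k + 2) * u' x)"
  have u': "u' x = ?u' x" if "x \<in> I" for x
    using Suc.prems(4)[OF that, symmetric] nz[OF that] by simp
  have du': "(u' has_vector_derivative ?u'' x) (at x within I)" if x: "x \<in> I" for x
  proof -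
    have i: "((\<lambda>x. inverse (of_real (x - a))) has_vector_derivative - (inverse (of_real (x - a)) ^ 2 :: 'a)) (at x within I)"
    proof -
      have "((\<lambda>x. inverse (x - a)) has_real_derivative - (inverse (x - a) ^ 2)) (at x within I)"
        using x by (auto intro!: derivative_eq_intros simp: power2_eq_square)
      from has_vector_derivative_of_real[OF this, where ?'a = 'a] show ?thesis by simp
    qed
    have "((\<lambda>x. f x - of_nat (k + 1) * u x) has_vector_derivative (vd f x - of_nat (k + 1) * u' x)) (at x within I)"
      using Suc.prems(1,3) x by (auto intro!: derivative_eq_intros)
    from has_vector_derivative_mult_field[OF i this]
    have "(?u' has_vector_derivative ?u'' x) (at x within I)"
    proof (rule has_vector_derivative_eq_rhs)
      define y where "y = (of_real (x - a) :: 'a)"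
      have "y \<noteq> 0" using nz[OF x] by (simp add: y_def)
      have e: "f x - of_nat (k + 1) * u x = y * u' x"
        using Suc.prems(4)[OF x] unfolding y_def by (metis add_diff_cancel_right')
      show "- (inverse (of_real (x - a)))\<^sup>2 * (f x - of_nat (k + 1) * u x)
          + inverse (of_real (x - a)) * (vd f x - of_nat (k + 1) * u' x) = ?u'' x"
        unfolding y_def[symmetric] e using \<open>y \<noteq> 0\<close> by (simp add: field_simps power2_eq_square)
    qed
    then show ?thesis by (subst has_vd_cong[of u' ?u', OF u' x])
  qed
  obtain C where C: "\<And>x. x \<in> I \<Longrightarrow> norm (vd f x) \<le> C"
    using Bd_bounded[of n "vd f"] Suc.prems(1) unfolding Bd.simps by blast
  obtain D where D: "\<And>x. x \<in> I \<Longrightarrow> norm (f x - of_nat (k + 1) * u x) \<le> D"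
  proof -
    have "Bd 0 u" "Bd 0 f" using Suc.prems by auto
    then have "Bd 0 (\<lambda>x. f x + of_nat (k + 1) * (- 1 * u x))" by (intro Bd_add Bd_mult Bd_const)
    then obtain D where "\<forall>x\<in>I. norm (f x + of_nat (k + 1) * (- 1 * u x)) \<le> D" by auto
    then show thesis by (intro that[of D]) simp
  qed
  let ?P' = "\<lambda>x. of_real (x - a) ^ (k + 1) * vd f x"
  \<comment> \<open>This equals \<open>(x - a) ^ (k + 2) * u' x\<close>, but is written without
    \<open>u'\<close>, which is not yet known to be bounded: boundedness of \<open>f\<close> and
    \<open>u\<close> then shows that \<open>?P\<close> tends to 0 at \<open>a\<close>.\<close>
  let ?P = "\<lambda>x. of_real (x - a) ^ (k + 1) * (f x - of_nat (k + 1) * u x)"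
  have Pu: "?P x = of_real (x - a) ^ (k + 2) * u' x" if "x \<in> I" for x
    using u'[OF that] nz[OF that] by simp
  have dP: "(?P has_vector_derivative of_real (x - a) ^ (k + 1) * vd f x) (at x within I)" if x: "x \<in> I" for x
  proof -
    have i: "((\<lambda>x. of_real (x - a) ^ (k + 1)) has_vector_derivative (of_nat (k + 1) * of_real (x - a) ^ k :: 'a)) (at x within I)"
    proof -
      have "((\<lambda>x. x - a) has_real_derivative 1) (at x within I)" by (auto intro!: derivative_eq_intros)
      from DERIV_power[OF this, of "k + 1"]
      have "((\<lambda>x. (x - a) ^ (k + 1)) has_real_derivative real (k + 1) * (x - a) ^ k) (at x within I)" by simp
      from has_vector_derivative_of_real[OF this, where ?'a = 'a] show ?thesis by simp
    qed
    have "((\<lambda>x. f x - of_nat (k + 1) * u x) has_vector_derivative (vd f x - of_nat (k + 1) * u' x)) (at x within I)"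
      using Suc.prems(1,3) x by (auto intro!: derivative_eq_intros)
    from has_vector_derivative_mult_field[OF i this]
    show ?thesis
    proof (rule has_vector_derivative_eq_rhs)
      define y where "y = (of_real (x - a) :: 'a)"
      have e: "f x - of_nat (k + 1) * u x = y * u' x"
        using Suc.prems(4)[OF x] unfolding y_def by (metis add_diff_cancel_right')
      show "of_nat (k + 1) * of_real (x - a) ^ k * (f x - of_nat (k + 1) * u x)
          + of_real (x - a) ^ (k + 1) * (vd f x - of_nat (k + 1) * u' x) = ?P' x"
        unfolding y_def[symmetric] e by (simp add: algebra_simps)
    qed
  qed
  have Plim: "(?P \<longlongrightarrow> 0) (at_right a)"
  proof (rule tendsto_zero_bound[OF ab, where C = "D" and p = "real (k + 1)"])
    fix x assume x: "x \<in> I"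
    have "norm (of_real (x - a) ^ (k + 1) :: 'a) = (x - a) powr real (k + 1)"
      using x unfolding norm_power norm_of_real by (subst powr_realpow) auto
    moreover have "(x - a) powr real (k + 1) * norm (f x - of_nat (k + 1) * u x) \<le> (x - a) powr real (k + 1) * D"
      by (intro mult_left_mono D x) simp
    ultimately show "norm (?P x) \<le> D * (x - a) powr real (k + 1)"
      unfolding norm_mult by (simp only: mult.commute)
  qed simp
  have "norm (u' x) \<le> C" if x: "x \<in> I" for x
  proof -
    have ax: "a < x" using x by simp
    \<comment> \<open>The mean value inequality is used on [y, x] and \<open>y\<close> is then sent
      to \<open>a\<close>, because only the limit of \<open>?P\<close> at \<open>a\<close> is
      controlled.\<close>
    have "norm (?P x - ?P y) \<le> C * (x - a) ^ (k + 1) * (x - a)" if y: "y \<in> {a<..<x}" for y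
    proof -
      have "norm (?P x - ?P y) \<le> C * (x - a) ^ (k + 1) * norm (x - y)"
      proof (rule differentiable_bound[where S = "{y..x}" and f' = "\<lambda>z t. t *\<^sub>R ?P' z"])
        fix z assume z: "z \<in> {y..x}"
        then have zI: "z \<in> I" using x y by auto
        have "(?P has_vector_derivative ?P' z) (at z within {y..x})"
          by (rule has_vector_derivative_within_subset[OF dP[OF zI]]) (use x y in auto)
        then show "(?P has_derivative (\<lambda>t. t *\<^sub>R ?P' z)) (at z within {y..x})"
          unfolding has_vector_derivative_def .
        have "norm (?P' z) \<le> (x - a) ^ (k + 1) * C"
          unfolding norm_mult norm_power norm_of_real using z zI C[OF zI]
          by (intro mult_mono power_mono) auto
        from mult_right_mono[OF this abs_ge_zero]
        show "onorm (\<lambda>t. t *\<^sub>R ?P' z) \<le> C * (x - a) ^ (k + 1)"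
          by (intro onorm_le) (simp only: norm_scaleR real_norm_def mult.commute)
      qed (use y in auto)
      also have "\<dots> \<le> C * (x - a) ^ (k + 1) * (x - a)"
      proof (rule mult_left_mono)
        have "C \<ge> 0" by (rule order_trans[OF norm_ge_zero C[OF x]])
        then show "0 \<le> C * (x - a) ^ (k + 1)" using x by auto
      qed (use y in auto)
      finally show ?thesis .
    qed
    then have ev: "eventually (\<lambda>y. norm (?P x - ?P y) \<le> C * (x - a) ^ (k + 1) * (x - a)) (at_right a)"
      by (rule eventually_at_rightI[OF _ ax])
    have lim: "((\<lambda>y. norm (?P x - ?P y)) \<longlongrightarrow> norm (?P x - 0)) (at_right a)"
      by (rule tendsto_norm[OF tendsto_diff[OF tendsto_const Plim]])
    have "norm (?P x - 0) \<le> C * (x - a) ^ (k + 1) * (x - a)"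
      by (rule tendsto_upperbound[OF lim ev trivial_limit_at_right_real])
    also have "norm (?P x - 0) = (x - a) ^ (k + 2) * norm (u' x)"
      unfolding Pu[OF x] diff_0_right norm_mult norm_power norm_of_real using x by simp
    finally have "(x - a) ^ (k + 2) * norm (u' x) \<le> (x - a) ^ (k + 2) * C" by (simp add: mult_ac)
    then show ?thesis using x by (simp add: mult_le_cancel_left)
  qed
  then have bu: "\<exists>C. \<forall>x\<in>I. norm (u' x) \<le> C" by blast
  have "Bd n u'"
  proof (rule Suc.IH[of "vd f" u' ?u'' "Suc k", OF _ bu])
    fix x assume "x \<in> I"
    then show "of_real (x - a) * ?u'' x + of_nat (Suc k + 1) * u' x = vd f x"
      unfolding mult.assoc[symmetric] right_inverse[OF nz[OF \<open>x \<in> I\<close>]] by simp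
  qed (use Suc.prems(1) du' in auto)
  with Suc.prems show ?case by (intro Bd_SucI)
qed auto


section \<open>Closure properties, and division by powers of \<open>x - a\<close>\<close>

lemma bsmooth_add: "bsmooth f \<Longrightarrow> bsmooth g \<Longrightarrow> bsmooth (\<lambda>x. f x + g x)"
  and bsmooth_mult: "bsmooth f \<Longrightarrow> bsmooth g \<Longrightarrow> bsmooth (\<lambda>x. f x * g x)"
  and bsmooth_const: "bsmooth (\<lambda>x. c)"
  and bsmooth_ident: "bsmooth (\<lambda>x. x)"
  and bsmooth_of_real: "bsmooth h \<Longrightarrow> bsmooth (\<lambda>x. of_real (h x) :: 'a::real_normed_field)"
  and bsmooth_vd: "bsmooth f \<Longrightarrow> bsmooth (vd f)"
  unfolding bsmooth_def by (simp_all add: Bd_add Bd_mult Bd_const Bd_ident Bd_of_real)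
   (metis Bd.simps(2))

lemma bsmooth_minus: "bsmooth f \<Longrightarrow> bsmooth (\<lambda>x. - f x)"
  using bsmooth_mult[OF bsmooth_const[of "-1"], of f] by simp

lemma bsmooth_diff: "bsmooth f \<Longrightarrow> bsmooth g \<Longrightarrow> bsmooth (\<lambda>x. f x - g x)"
  using bsmooth_add[OF _ bsmooth_minus, of f g] by simp

lemma bsmooth_sum: "(\<And>i. i \<in> A \<Longrightarrow> bsmooth (f i)) \<Longrightarrow> bsmooth (\<lambda>x. \<Sum>i\<in>A. f i x)"
  by (induction A rule: infinite_finite_induct) (auto intro: bsmooth_const bsmooth_add)

lemma bsmooth_power: "bsmooth f \<Longrightarrow> bsmooth (\<lambda>x. f x ^ k)"
  by (induction k) (auto intro: bsmooth_const bsmooth_mult)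

lemma bsmooth_inverse:
  fixes f :: "real \<Rightarrow> real"
  shows "c > 0 \<Longrightarrow> (\<And>x. x \<in> I \<Longrightarrow> f x \<ge> c) \<Longrightarrow> bsmooth f \<Longrightarrow> bsmooth (\<lambda>x. inverse (f x))"
  unfolding bsmooth_def by (intro allI Bd_inverse[of c]) auto

lemma bsmooth_powr:
  fixes f :: "real \<Rightarrow> real"
  shows "c > 0 \<Longrightarrow> (\<And>x. x \<in> I \<Longrightarrow> f x \<ge> c) \<Longrightarrow> bsmooth f \<Longrightarrow> bsmooth (\<lambda>x. f x powr p)"
  unfolding bsmooth_def by (intro allI Bd_powr[of c]) auto

lemma bsmooth_cong: "(\<And>x. x \<in> I \<Longrightarrow> f x = g x) \<Longrightarrow> bsmooth f \<longleftrightarrow> bsmooth g"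
  unfolding bsmooth_def using Bd_cong[of f g] by simp

lemma bsmooth_bounded: "bsmooth f \<Longrightarrow> \<exists>C. \<forall>x\<in>I. norm (f x) \<le> C"
  unfolding bsmooth_def using Bd_bounded[of 0 f] by simp

lemma bsmooth_boundedE:
  assumes "bsmooth f"
  obtains C where "C > 0" "\<And>x. x \<in> I \<Longrightarrow> norm (f x) \<le> C"
proof -
  obtain C where C: "\<forall>x\<in>I. norm (f x) \<le> C" using bsmooth_bounded[OF assms] by blast
  show thesis by (rule that[of "max C 1"]) (use C in fastforce)+
qed

lemma bsmooth_deriv: "bsmooth f \<Longrightarrow> x \<in> I \<Longrightarrow> (f has_vector_derivative vd f x) (at x within I)"
  unfolding bsmooth_def using Bd.simps(2)[of 0 f] by blast

text \<open>The quotient q satisfies (x-a) q' + q = f', the case \<open>k = 0\<close> of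
  \<open>Bd_euler_ode\<close>; the assumed bound on \<open>f\<close> is the boundedness of q
  required there.\<close>

lemma bsmooth_div:
  fixes f :: "real \<Rightarrow> 'a::real_normed_field"
  assumes f: "bsmooth f" and C: "\<And>x. x \<in> I \<Longrightarrow> norm (f x) \<le> C * (x - a)"
  shows "bsmooth (\<lambda>x. inverse (of_real (x - a)) * f x)"
proof -
  let ?q = "\<lambda>x. inverse (of_real (x - a)) * f x"
  let ?q' = "\<lambda>x. inverse (of_real (x - a)) * (vd f x - ?q x)"
  have nz: "of_real (x - a) \<noteq> (0 :: 'a)" if "x \<in> I" for x using that by auto
  have "Bd n ?q" for n
  proof (rule Bd_euler_ode[where f = "vd f" and k = 0 and u' = ?q'])
    show "Bd n (vd f)" using bsmooth_vd[OF f] by (simp add: bsmooth_def)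
    show "\<exists>C. \<forall>x\<in>I. norm (?q x) \<le> C"
    proof (intro exI ballI)
      fix x assume x: "x \<in> I"
      then have "norm (?q x) = norm (f x) / (x - a)"
        unfolding norm_mult norm_inverse norm_of_real by (simp add: field_simps)
      also have "\<dots> \<le> C" using C[OF x] x by (simp add: divide_le_eq)
      finally show "norm (?q x) \<le> C" .
    qed
  next
    fix x assume x: "x \<in> I"
    have "((\<lambda>x. inverse (x - a)) has_real_derivative - (inverse (x - a) ^ 2)) (at x within I)"
      using x by (auto intro!: derivative_eq_intros simp: power2_eq_square)
    from has_vector_derivative_of_real[OF this, where ?'a = 'a]
    have i: "((\<lambda>x. inverse (of_real (x - a))) has_vector_derivative - (inverse (of_real (x - a)) ^ 2 :: 'a)) (at x within I)"
      by simp
    show "(?q has_vector_derivative ?q' x) (at x within I)"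
      by (rule has_vector_derivative_eq_rhs[OF has_vector_derivative_mult_field[OF i bsmooth_deriv[OF f x]]])
        (simp add: algebra_simps power2_eq_square)
    show "of_real (x - a) * ?q' x + of_nat (0 + 1) * ?q x = vd f x"
      unfolding mult.assoc[symmetric] right_inverse[OF nz[OF x]] by simp
  qed
  then show ?thesis by (simp add: bsmooth_def)
qed

lemma bsmooth_div_power:
  fixes f :: "real \<Rightarrow> 'a::real_normed_field"
  assumes f: "bsmooth f" and C: "\<And>x. x \<in> I \<Longrightarrow> norm (f x) \<le> C * (x - a) ^ N"
  shows "bsmooth (\<lambda>x. inverse (of_real (x - a)) ^ N * f x)"
  using C
proof (induction N arbitrary: C)
  case 0
  then show ?case using f by simp
next
  case (Suc N)
  \<comment> \<open>One factor \<open>x - a\<close> is traded for \<open>b - a\<close> to meet the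
    induction hypothesis; \<open>max C 0\<close> spares a discussion of the sign of
    \<open>C\<close>.\<close>
  have "norm (f x) \<le> max C 0 * (b - a) * (x - a) ^ N" if x: "x \<in> I" for x
  proof -
    have "C * (x - a) ^ Suc N \<le> max C 0 * (x - a) ^ Suc N" using x by (intro mult_right_mono) auto
    also have "\<dots> = max C 0 * (x - a) ^ N * (x - a)" by simp
    also have "\<dots> \<le> max C 0 * (x - a) ^ N * (b - a)" using x by (intro mult_left_mono) auto
    finally show ?thesis using Suc.prems[OF x] by (simp add: mult_ac)
  qed
  then have b: "bsmooth (\<lambda>x. inverse (of_real (x - a)) ^ N * f x)" by (rule Suc.IH)
  have "bsmooth (\<lambda>x. inverse (of_real (x - a)) * (inverse (of_real (x - a)) ^ N * f x))"
  proof (rule bsmooth_div[OF b, where C = C])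
    fix x assume x: "x \<in> I"
    have "norm (inverse (of_real (x - a)) ^ N * f x) = norm (f x) / (x - a) ^ N"
      unfolding norm_mult norm_inverse norm_power norm_of_real using x by (simp add: field_simps)
    also have "\<dots> \<le> C * (x - a)" using Suc.prems[OF x] x by (simp add: divide_le_eq mult_ac)
    finally show "norm (inverse (of_real (x - a)) ^ N * f x) \<le> C * (x - a)" .
  qed
  then show ?case by (simp add: mult.assoc)
qed

section \<open>Order of vanishing at \<open>b\<close>\<close>

definition flat :: "nat \<Rightarrow> (real \<Rightarrow> 'a::real_normed_field) \<Rightarrow> bool" where
  "flat m f \<longleftrightarrow> (\<forall>j<m. (vd ^^ j) f b = 0)"

lemma b_in_I: "b \<in> I" using ab by simp

lemma flat_0 [simp]: "flat 0 f" by (simp add: flat_def)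

lemma flat_Suc: "flat (Suc m) f \<longleftrightarrow> f b = 0 \<and> flat m (vd f)"
  unfolding flat_def
  by (auto simp: less_Suc_eq_0_disj funpow_swap1 simp flip: funpow_Suc_right)

lemma flat_cong: "(\<And>x. x \<in> I \<Longrightarrow> f x = g x) \<Longrightarrow> flat m f \<Longrightarrow> flat m g"
proof (induction m arbitrary: f g)
  case (Suc m)
  have "flat m (vd g)"
    by (rule Suc.IH[of "vd f"]) (use Suc.prems vd_cong[of f g] in \<open>auto simp: flat_Suc\<close>)
  moreover have "g b = 0" using Suc.prems(1)[OF b_in_I] Suc.prems(2) by (simp add: flat_Suc)
  ultimately show ?case by (simp add: flat_Suc)
qed simp

lemma flat_antimono: "flat m f \<Longrightarrow> k \<le> m \<Longrightarrow> flat k f"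
  by (auto simp: flat_def)

lemma flat_add: "bsmooth f \<Longrightarrow> bsmooth g \<Longrightarrow> flat m f \<Longrightarrow> flat m g \<Longrightarrow> flat m (\<lambda>x. f x + g x)"
proof (induction m arbitrary: f g)
  case (Suc m)
  have "flat m (\<lambda>x. vd f x + vd g x)"
    by (rule Suc.IH) (use Suc.prems in \<open>simp_all add: flat_Suc bsmooth_vd\<close>)
  then have "flat m (vd (\<lambda>x. f x + g x))"
  proof (rule flat_cong[rotated])
    fix x assume x: "x \<in> I"
    show "vd f x + vd g x = vd (\<lambda>x. f x + g x) x"
      by (rule vdI[OF _ x, symmetric]) (intro has_vector_derivative_add bsmooth_deriv Suc.prems x)
  qed
  then show ?case using Suc.prems by (simp add: flat_Suc)
qed simp

lemma vd_mult: "bsmooth f \<Longrightarrow> bsmooth g \<Longrightarrow> x \<in> I \<Longrightarrow> vd (\<lambda>x. f x * g x) x = vd f x * g x + f x * vd g x"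
  by (rule vdI) (intro has_vector_derivative_mult_field bsmooth_deriv)

lemma flat_mult: "bsmooth f \<Longrightarrow> bsmooth g \<Longrightarrow> flat m f \<Longrightarrow> flat m (\<lambda>x. f x * g x)"
proof (induction m arbitrary: f g)
  case (Suc m)
  have "flat m (\<lambda>x. vd f x * g x + f x * vd g x)"
    using Suc.prems bsmooth_vd[OF Suc.prems(1)] bsmooth_vd[OF Suc.prems(2)]
      flat_antimono[OF Suc.prems(3), of m]
    by (intro flat_add bsmooth_mult Suc.IH) (simp_all add: flat_Suc)
  then have "flat m (vd (\<lambda>x. f x * g x))"
    by (rule flat_cong[rotated]) (rule vd_mult[OF Suc.prems(1,2), symmetric])
  then show ?case using Suc.prems by (simp add: flat_Suc)
qed simp

lemma flat_of_real: "bsmooth f \<Longrightarrow> flat m f \<Longrightarrow> flat m (\<lambda>x. of_real (f x) :: 'a::real_normed_field)"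
proof (induction m arbitrary: f)
  case (Suc m)
  have "flat m (\<lambda>x. of_real (vd f x) :: 'a)"
    by (rule Suc.IH) (use Suc.prems in \<open>simp_all add: flat_Suc bsmooth_vd\<close>)
  then have "flat m (vd (\<lambda>x. of_real (f x) :: 'a))"
  proof (rule flat_cong[rotated])
    fix x assume x: "x \<in> I"
    show "of_real (vd f x) = vd (\<lambda>x. of_real (f x) :: 'a) x"
      by (rule vdI[OF _ x, symmetric]) (intro has_vector_derivative_of_real
        bsmooth_deriv[OF Suc.prems(1) x, folded has_real_derivative_iff_has_vector_derivative])
  qed
  then show ?case using Suc.prems by (simp add: flat_Suc)
qed simp

text \<open>With S known to be flat to order m, S'P = (SP)' - SP' is flat to order m as well, and
  the induction hypothesis applied to S' cancels P there. It transfers the zero at \<open>b\<close>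
  from the interpolation error to its quotient by a power of \<open>x - a\<close>.\<close>

lemma flat_cancel:
  assumes "P b \<noteq> 0"
  shows "bsmooth S \<Longrightarrow> bsmooth P \<Longrightarrow> flat m (\<lambda>x. S x * P x) \<Longrightarrow> flat m S"
proof (induction m arbitrary: S)
  case (Suc m)
  have S: "bsmooth S" and P: "bsmooth P" by (fact Suc.prems)+
  have fS: "flat m S"
    by (rule Suc.IH[OF S P flat_antimono[OF Suc.prems(3)]]) simp
  have "flat m (vd (\<lambda>x. S x * P x))" using Suc.prems(3) by (simp add: flat_Suc)
  moreover have "flat m (\<lambda>x. S x * - vd P x)" by (intro flat_mult S bsmooth_minus bsmooth_vd P fS)
  ultimately have "flat m (\<lambda>x. vd (\<lambda>x. S x * P x) x + S x * - vd P x)"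
    by (intro flat_add bsmooth_vd bsmooth_mult bsmooth_minus S P)
  then have "flat m (\<lambda>x. vd S x * P x)"
    by (rule flat_cong[rotated]) (simp add: vd_mult[OF S P])
  then have "flat m (vd S)" by (rule Suc.IH[OF bsmooth_vd[OF S] P])
  moreover have "S b = 0" using Suc.prems(3) assms by (simp add: flat_Suc)
  ultimately show ?case by (simp add: flat_Suc)
qed simp

section \<open>Comparison with the derivatives \<open>nderiv\<close> of the statement\<close>

lemma vd_funpow_diff:
  assumes f: "bsmooth f" and g: "bsmooth g"
  shows "x \<in> I \<Longrightarrow> (vd ^^ j) (\<lambda>x. f x - g x) x = (vd ^^ j) f x - (vd ^^ j) g x"
proof (induction j arbitrary: x)
  case (Suc j)
  have b: "bsmooth ((vd ^^ j) f)" "bsmooth ((vd ^^ j) g)"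
    by (induction j) (auto intro: f g bsmooth_vd)
  have "vd ((vd ^^ j) (\<lambda>x. f x - g x)) x = vd (\<lambda>x. (vd ^^ j) f x - (vd ^^ j) g x) x"
    by (rule vd_cong[OF Suc.IH Suc.prems])
  also have "\<dots> = vd ((vd ^^ j) f) x - vd ((vd ^^ j) g) x"
    by (intro vdI has_vector_derivative_diff bsmooth_deriv b Suc.prems)
  finally show ?case by simp
qed simp

text \<open>Every point of (a, b] is a limit point of it, so derivatives within it are unique and
  the definite description in \<open>nderiv\<close> denotes the derivative.\<close>

lemma nderiv_I: "bsmooth f \<Longrightarrow> x \<in> I \<Longrightarrow> nderiv j I f x = (vd ^^ j) f x"
proof (induction j arbitrary: x)
  case (Suc j)
  have b: "bsmooth ((vd ^^ j) f)" by (induction j) (auto intro: Suc.prems bsmooth_vd)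
  have "(nderiv j I f has_real_derivative D) (at x within I) \<longleftrightarrow> D = vd ((vd ^^ j) f) x" for D
    unfolding has_real_derivative_iff_has_vector_derivative
    using has_vd_cong[of "nderiv j I f" "(vd ^^ j) f" x D, OF Suc.IH[OF Suc.prems(1)] Suc.prems(2)] vdI[OF _ Suc.prems(2)]
      bsmooth_deriv[OF b Suc.prems(2)] by auto
  then show ?case by simp
qed simp

lemma smooth_on_bsmooth:
  assumes f: "smooth_on {a..b} f"
  shows "bsmooth (nderiv j {a..b} f)"
proof -
  have d: "(nderiv k {a..b} f has_real_derivative nderiv (Suc k) {a..b} f x) (at x within {a..b})"
    if "x \<in> {a..b}" for k x using f that unfolding smooth_on_def by blast
  have bd: "\<exists>C. \<forall>x\<in>I. norm (nderiv k {a..b} f x) \<le> C" for k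
  proof -
    have "continuous_on {a..b} (nderiv k {a..b} f)"
      using DERIV_continuous_on[OF d] by blast
    then have "bounded (nderiv k {a..b} f ` {a..b})"
      by (intro compact_imp_bounded compact_continuous_image) auto
    then obtain B where "\<forall>y\<in>nderiv k {a..b} f ` {a..b}. norm y \<le> B" unfolding bounded_iff by blast
    then show ?thesis by (intro exI[of _ B]) auto
  qed
  have "Bd n (nderiv k {a..b} f)" for n k
  proof (induction n arbitrary: k)
    case (Suc n)
    show ?case
    proof (rule Bd_SucI[OF bd _ Suc.IH])
      fix x assume "x \<in> I"
      then show "(nderiv k {a..b} f has_vector_derivative nderiv (Suc k) {a..b} f x) (at x within I)"
        unfolding has_real_derivative_iff_has_vector_derivative[symmetric]
        by (intro DERIV_subset[OF d[of x k]]) auto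
    qed
  qed (use bd in simp)
  then show ?thesis by (simp add: bsmooth_def)
qed

lemma vd_nderiv:
  assumes f: "smooth_on {a..b} f"
  shows "x \<in> I \<Longrightarrow> (vd ^^ j) f x = nderiv j {a..b} f x"
proof (induction j arbitrary: x)
  case (Suc j)
  have "vd ((vd ^^ j) f) x = vd (nderiv j {a..b} f) x"
    using Suc.IH Suc.prems by (intro vd_cong)
  also have "\<dots> = nderiv (Suc j) {a..b} f x"
  proof (rule vdI[OF _ Suc.prems])
    have "(nderiv j {a..b} f has_real_derivative nderiv (Suc j) {a..b} f x) (at x within {a..b})"
      using f Suc.prems unfolding smooth_on_def by force
    then show "(nderiv j {a..b} f has_vector_derivative nderiv (Suc j) {a..b} f x) (at x within I)"
      unfolding has_real_derivative_iff_has_vector_derivative[symmetric]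
      by (rule DERIV_subset) auto
  qed
  finally show ?case by simp
qed simp

text \<open>Taylor's estimate with the derivatives at \<open>a\<close> replaced by their limits. The
  bound for f' is integrated by the mean value inequality, which keeps the same constant and gives
  up only the factorial.\<close>

lemma bsmooth_taylor_bound:
  fixes f :: "real \<Rightarrow> 'a::real_normed_field"
  assumes "bsmooth f" "\<And>j. j < N \<Longrightarrow> ((vd ^^ j) f \<longlongrightarrow> 0) (at_right a)"
  shows "\<exists>C. \<forall>x\<in>I. norm (f x) \<le> C * (x - a) ^ N"
  using assms
proof (induction N arbitrary: f)
  case 0
  then show ?case using bsmooth_bounded[of f] by simp
next
  case (Suc N)
  have "((vd ^^ j) (vd f) \<longlongrightarrow> 0) (at_right a)" if "j < N" for j
    using Suc.prems(2)[of "Suc j"] that by (simp add: funpow_swap1)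
  then obtain C where C: "\<forall>x\<in>I. norm (vd f x) \<le> C * (x - a) ^ N"
    using Suc.IH[of "vd f"] bsmooth_vd[OF Suc.prems(1)] by blast
  have lim: "(f \<longlongrightarrow> 0) (at_right a)" using Suc.prems(2)[of 0] by simp
  show ?case
  proof (intro exI ballI)
    fix x assume x: "x \<in> I"
    then have ax: "a < x" by simp
    have "0 \<le> C * (x - a) ^ N" using C x norm_ge_zero order_trans by blast
    moreover have "(x - a) ^ N > 0" using x by simp
    ultimately have C0: "C \<ge> 0" by (simp add: zero_le_mult_iff)
    have bd: "norm (f x - f y) \<le> C * (x - a) ^ Suc N" if y: "y \<in> {a<..<x}" for y
    proof -
      have "norm (f x - f y) \<le> C * (x - a) ^ N * norm (x - y)"
      proof (rule differentiable_bound[where S = "{y..x}" and f' = "\<lambda>z t. t *\<^sub>R vd f z"])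
        fix z assume z: "z \<in> {y..x}"
        then have zI: "z \<in> I" using x y by auto
        have "(f has_vector_derivative vd f z) (at z within {y..x})"
          by (rule has_vector_derivative_within_subset[OF bsmooth_deriv[OF Suc.prems(1) zI]])
            (use x y in auto)
        then show "(f has_derivative (\<lambda>t. t *\<^sub>R vd f z)) (at z within {y..x})"
          unfolding has_vector_derivative_def .
        have "C * (z - a) ^ N \<le> C * (x - a) ^ N"
          using C0 z zI by (intro mult_left_mono power_mono) auto
        then have "norm (vd f z) \<le> C * (x - a) ^ N" using C zI by fastforce
        from mult_right_mono[OF this abs_ge_zero]
        show "onorm (\<lambda>t. t *\<^sub>R vd f z) \<le> C * (x - a) ^ N"
          by (intro onorm_le) (simp only: norm_scaleR real_norm_def mult.commute)
      qed (use y in auto)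
      also have "\<dots> \<le> C * (x - a) ^ N * (x - a)"
        using C0 x y by (intro mult_left_mono) auto
      finally show ?thesis by (simp add: mult_ac)
    qed
    then have ev: "eventually (\<lambda>y. norm (f x - f y) \<le> C * (x - a) ^ Suc N) (at_right a)"
      by (rule eventually_at_rightI[OF _ ax])
    have "((\<lambda>y. norm (f x - f y)) \<longlongrightarrow> norm (f x - 0)) (at_right a)"
      by (rule tendsto_norm[OF tendsto_diff[OF tendsto_const lim]])
    from tendsto_upperbound[OF this ev trivial_limit_at_right_real]
    show "norm (f x) \<le> C * (x - a) ^ Suc N" by simp
  qed
qed

end

section \<open>Oscillatory integrals with a stationary point\<close>

text \<open>Two uses are served: the singular endpoint \<open>c = a\<close> with an exponent above
  -1, and exponents below -1 on an interval away from \<open>a\<close>.\<close>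

lemma has_integral_powr_shift:
  fixes a c d q :: real
  assumes "a \<le> c" "c \<le> d" "q \<noteq> -1" "a < c \<or> q > -1"
  shows "((\<lambda>x. (x - a) powr q) has_integral ((d - a) powr (q + 1) - (c - a) powr (q + 1)) / (q + 1)) {c..d}"
proof -
  have "((\<lambda>x. (x - a) powr q) has_integral (d - a) powr (q + 1) / (q + 1) - (c - a) powr (q + 1) / (q + 1)) {c..d}"
  proof (rule fundamental_theorem_of_calculus_interior[OF assms(2)])
    show "continuous_on {c..d} (\<lambda>x. (x - a) powr (q + 1) / (q + 1))"
    proof (cases "a < c")
      case True
      then show ?thesis using assms by (intro continuous_intros) auto
    next
      case False
      then show ?thesis using assms
        by (intro continuous_on_divide continuous_on_powr' continuous_intros) auto
    qed
    fix x assume x: "x \<in> {c<..<d}"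
    show "((\<lambda>x. (x - a) powr (q + 1) / (q + 1)) has_vector_derivative (x - a) powr q) (at x)"
      unfolding has_real_derivative_iff_has_vector_derivative[symmetric]
      using x assms by (auto intro!: derivative_eq_intros)
  qed
  then show ?thesis by (simp add: diff_divide_distrib)
qed

text \<open>The model is \<open>\<gamma>\<close> = |g| with its zero at \<open>a\<close> factored
  out, both from the function and from its derivative. The common lower bound \<open>c\<close> keeps
  inverses and real powers of \<open>G\<close> and \<open>G1\<close> smooth up to
  \<open>a\<close>.\<close>

locale phase = half_open +
  fixes r :: nat and \<gamma> G G1 :: "real \<Rightarrow> real" and c :: real
  assumes r1: "r \<ge> 1"
    and gam: "\<And>x. x \<in> I \<Longrightarrow> \<gamma> x = (x - a) ^ (r + 1) * G x"
    and dgam: "\<And>x. x \<in> I \<Longrightarrow> (\<gamma> has_real_derivative (x - a) ^ r * G1 x) (at x within I)"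
    and bG: "bsmooth G" and bG1: "bsmooth G1"
    and c: "c > 0" and Gc: "\<And>x. x \<in> I \<Longrightarrow> G x \<ge> c" and G1c: "\<And>x. x \<in> I \<Longrightarrow> G1 x \<ge> c"
begin

definition J :: "complex \<Rightarrow> real \<Rightarrow> real \<Rightarrow> complex" where
  "J \<mu> \<omega> x = besselJ \<mu> (of_real (\<omega> * \<gamma> x))"

lemma G_pos: "x \<in> I \<Longrightarrow> G x > 0" and G1_pos: "x \<in> I \<Longrightarrow> G1 x > 0"
  using c Gc G1c by fastforce+

lemma gam_pos: "x \<in> I \<Longrightarrow> \<gamma> x > 0"
  using gam G_pos by simp

lemma J_deriv:
  assumes "\<omega> > 0" "x \<in> I"
  shows "(J (\<mu> + 1) \<omega> has_vector_derivative
    of_real (\<omega> * ((x - a) ^ r * G1 x)) * (J \<mu> \<omega> x - (\<mu> + 1) / of_real (\<omega> * \<gamma> x) * J (\<mu> + 1) \<omega> x)) (at x within I)"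
proof -
  have s: "\<omega> * \<gamma> x > 0" using assms gam_pos by simp
  have "((\<lambda>x. \<omega> * \<gamma> x) has_vector_derivative \<omega> * ((x - a) ^ r * G1 x)) (at x within I)"
    unfolding has_real_derivative_iff_has_vector_derivative[symmetric]
    by (intro DERIV_cmult dgam assms)
  from vector_diff_chain_within[OF this besselJ_deriv2[OF s, of \<mu>]]
  show ?thesis by (simp add: J_def[abs_def] o_def scaleR_conv_of_real)
qed

text \<open>What remains, up to the power of \<open>x - a\<close>, of an integration by parts of
  \<open>(x - a) powr (k + r) * U * G1 * J \<mu> \<omega>\<close>.\<close>
definition ibp_coeff :: "complex \<Rightarrow> real \<Rightarrow> (real \<Rightarrow> complex) \<Rightarrow> real \<Rightarrow> complex" where
  "ibp_coeff \<mu> k U x = U x * of_real (G1 x * inverse (G x)) * (\<mu> + 1) - U x * of_real k - vd U x * of_real (x - a)"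

lemma bsmooth_inverse_G: "bsmooth (\<lambda>x. inverse (G x))"
  and bsmooth_inverse_G1: "bsmooth (\<lambda>x. inverse (G1 x))"
  by (rule bsmooth_inverse[OF c Gc bG] bsmooth_inverse[OF c G1c bG1]; assumption)+

lemma bsmooth_ibp_coeff: "bsmooth U \<Longrightarrow> bsmooth (ibp_coeff \<mu> k U)"
  unfolding ibp_coeff_def[abs_def]
  by (intro bsmooth_diff bsmooth_mult bsmooth_of_real bsmooth_inverse_G bG1 bsmooth_const bsmooth_ident bsmooth_vd)

text \<open>The term with \<open>vd U\<close> costs one order of vanishing at \<open>b\<close>; the
  other terms keep it.\<close>

lemma flat_ibp_coeff:
  assumes "bsmooth U" "flat (Suc m) U"
  shows "flat m (ibp_coeff \<mu> k U)"
proof -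
  let ?A = "\<lambda>x. of_real (G1 x * inverse (G x)) * (\<mu> + 1) - of_real k :: complex"
  let ?B = "\<lambda>x. - of_real (x - a) :: complex"
  have "bsmooth ?A"
    by (intro bsmooth_diff bsmooth_mult bsmooth_of_real bsmooth_inverse_G bG1 bsmooth_const)
  moreover have "bsmooth ?B" by (intro bsmooth_minus bsmooth_of_real bsmooth_diff bsmooth_ident bsmooth_const)
  moreover have "flat m U" "flat m (vd U)" using assms flat_antimono[of "Suc m" U m] by (auto simp: flat_Suc)
  ultimately have "flat m (\<lambda>x. U x * ?A x + vd U x * ?B x)"
    using assms by (intro flat_add flat_mult bsmooth_mult bsmooth_vd) auto
  moreover have "ibp_coeff \<mu> k U = (\<lambda>x. U x * ?A x + vd U x * ?B x)"
    by (simp add: ibp_coeff_def fun_eq_iff algebra_simps)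
  ultimately show ?thesis by simp
qed

text \<open>In the second term of \<open>J_deriv\<close> the factor \<omega> cancels against
  \<open>1 / (\<omega> * \<gamma> x)\<close>, since the logarithmic derivative of
  \<open>\<gamma>\<close> is G1 / (G (x-a)). The remainder is thus free of \<omega>, at the price of
  r+1 powers of \<open>x - a\<close>. The exponent \<open>k\<close> may be negative.\<close>

lemma J_product_deriv:
  assumes U: "bsmooth U" and w: "\<omega> > 0" and x: "x \<in> I"
  shows "((\<lambda>x. of_real ((x - a) powr k) * U x * J (\<mu> + 1) \<omega> x) has_vector_derivative
     of_real \<omega> * (of_real ((x - a) powr (k + real r)) * (U x * of_real (G1 x)) * J \<mu> \<omega> x)
       - of_real ((x - a) powr (k - 1)) * ibp_coeff \<mu> k U x * J (\<mu> + 1) \<omega> x) (at x within I)"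
proof -
  define t where "t = x - a"
  define P where "P = t powr (k - 1)"
  have t: "t > 0" using x by (simp add: t_def)
  have "((\<lambda>x. (x - a) powr k) has_real_derivative k * (x - a) powr (k - 1)) (at x within I)"
    using x by (auto intro!: derivative_eq_intros)
  from has_vector_derivative_of_real[OF this, where ?'a = complex]
  have 1: "((\<lambda>x. complex_of_real ((x - a) powr k)) has_vector_derivative of_real (k * P)) (at x within I)"
    by (simp add: P_def t_def)
  note d = has_vector_derivative_mult_field[OF has_vector_derivative_mult_field[OF 1 bsmooth_deriv[OF U x]] J_deriv[OF w x, of \<mu>]]
  have k: "t powr k = P * t" using t by (simp add: P_def powr_mult_base mult.commute)
  have kr: "t powr (k + real r) = P * t * t ^ r" using t k by (simp add: powr_add powr_realpow)
  have g: "\<gamma> x = t ^ r * t * G x" using gam[OF x] by (simp add: t_def)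
  have Gx: "G x \<noteq> 0" using G_pos[OF x] by simp
  show ?thesis
    apply (rule has_vector_derivative_eq_rhs[OF d])
    unfolding t_def[symmetric] P_def[symmetric] k kr g ibp_coeff_def
    using w t Gx by (simp add: field_simps)
qed

text \<open>The threshold \<open>M\<close> is free for two uses: \<open>M = 1\<close> gives the
  inner region of the asymptotic estimate, and \<open>M = \<omega> * (b - a) ^ (r + 1)\<close>
  covers all of (a, b] at a fixed frequency.\<close>

lemma J_small:
  obtains C where "C > 0" "\<And>\<omega> x. \<omega> > 0 \<Longrightarrow> x \<in> I \<Longrightarrow> \<omega> * (x - a) ^ (r + 1) \<le> M \<Longrightarrow>
    norm (J \<mu> \<omega> x) \<le> C * (\<omega> powr Re \<mu> * (x - a) powr ((real r + 1) * Re \<mu>))"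
proof -
  obtain B where B: "B > 0" "\<And>x. x \<in> I \<Longrightarrow> norm (G x) \<le> B" using bsmooth_boundedE[OF bG] by blast
  have "bsmooth (\<lambda>x. G x powr Re \<mu>)" by (rule bsmooth_powr[OF c Gc bG])
  then obtain B' where B': "B' > 0" "\<And>x. x \<in> I \<Longrightarrow> norm (G x powr Re \<mu>) \<le> B'" using bsmooth_boundedE by blast
  obtain C where C: "C \<ge> 0" "\<And>s. 0 < s \<Longrightarrow> s \<le> M * B \<Longrightarrow> norm (besselJ \<mu> (of_real s)) \<le> C * s powr (Re \<mu>)"
    using besselJ_small[of "M * B" \<mu>] by blast
  show thesis
  proof (rule that)
    show "(C + 1) * B' > 0" using C B' by simp
    fix \<omega> x assume w: "\<omega> > 0" and x: "x \<in> I" and M: "\<omega> * (x - a) ^ (r + 1) \<le> M"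
    have s: "\<omega> * \<gamma> x > 0" using w x gam_pos by simp
    have pos: "\<omega> * (x - a) ^ (r + 1) \<ge> 0" using w x by simp
    have "\<omega> * \<gamma> x = \<omega> * (x - a) ^ (r + 1) * G x" using gam[OF x] by simp
    also have "\<dots> \<le> M * B" using M B(1) B(2)[OF x] G_pos[OF x] pos by (intro mult_mono) auto
    finally have "norm (J \<mu> \<omega> x) \<le> C * (\<omega> * \<gamma> x) powr Re \<mu>" unfolding J_def by (rule C(2)[OF s])
    also have "(\<omega> * \<gamma> x) powr Re \<mu> = G x powr Re \<mu> * (\<omega> powr Re \<mu> * (x - a) powr ((real r + 1) * Re \<mu>))"
    proof -
      have "(x - a) ^ (r + 1) = (x - a) powr (real r + 1)"
        using x powr_realpow[of "x - a" "r + 1"] by (simp add: add.commute)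
      then show ?thesis unfolding gam[OF x]
        using x w G_pos[OF x] by (simp add: powr_mult powr_powr mult_ac)
    qed
    also have "C * (G x powr Re \<mu> * (\<omega> powr Re \<mu> * (x - a) powr ((real r + 1) * Re \<mu>)))
      \<le> (C + 1) * (B' * (\<omega> powr Re \<mu> * (x - a) powr ((real r + 1) * Re \<mu>)))"
      using B'(2)[OF x] C(1) B'(1) by (intro mult_mono) auto
    finally show "norm (J \<mu> \<omega> x) \<le> (C + 1) * B' * (\<omega> powr Re \<mu> * (x - a) powr ((real r + 1) * Re \<mu>))"
      by (simp add: mult_ac)
  qed
qed

text \<open>Here the argument \<omega> \<open>\<gamma>\<close> is at least \<open>c\<close>, by the
  lower bound on \<open>G\<close>, so \<open>besselJ_bounded\<close> applies uniformly in
  \<omega>.\<close>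

lemma J_large:
  obtains C where "C > 0" "\<And>\<omega> x. \<omega> > 0 \<Longrightarrow> x \<in> I \<Longrightarrow> \<omega> * (x - a) ^ (r + 1) \<ge> 1 \<Longrightarrow> norm (J \<mu> \<omega> x) \<le> C"
proof -
  obtain C where C: "\<And>s. s \<ge> c \<Longrightarrow> norm (besselJ \<mu> (of_real s)) \<le> C" using besselJ_bounded[OF c] by blast
  show thesis
  proof (rule that)
    show "max C 1 > 0" by simp
    fix \<omega> x assume w: "\<omega> > 0" and x: "x \<in> I" and M: "\<omega> * (x - a) ^ (r + 1) \<ge> 1"
    have "1 * c \<le> (\<omega> * (x - a) ^ (r + 1)) * G x" using M Gc[OF x] c by (intro mult_mono) auto
    then have "c \<le> \<omega> * \<gamma> x" using gam[OF x] by (simp add: mult.assoc)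
    from C[OF this] show "norm (J \<mu> \<omega> x) \<le> max C 1" by (simp add: J_def)
  qed
qed

lemma continuous_J: "\<omega> > 0 \<Longrightarrow> continuous_on I (J \<mu> \<omega>)"
  unfolding continuous_on_eq_continuous_within
  using has_vector_derivative_continuous[OF J_deriv[of \<omega> _ "\<mu> - 1"]] by simp

lemma continuous_bsmooth: "bsmooth f \<Longrightarrow> continuous_on I f"
  unfolding continuous_on_eq_continuous_within
  using has_vector_derivative_continuous[OF bsmooth_deriv] by blast

text \<open>The constant depends on \<omega>. The bound serves integrability and the boundary term
  at \<open>a\<close> for each fixed frequency, not the asymptotics.\<close>

lemma powr_J_bound:
  assumes S: "bsmooth S" and w: "\<omega> > 0"
  obtains C where "\<And>x. x \<in> I \<Longrightarrow> norm (of_real ((x - a) powr p) * S x * J \<mu> \<omega> x) \<le> C * (x - a) powr (p + (real r + 1) * Re \<mu>)"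
proof -
  obtain B where B: "B > 0" "\<And>x. x \<in> I \<Longrightarrow> norm (S x) \<le> B" using bsmooth_boundedE[OF S] by blast
  obtain C where C: "C > 0" "\<And>\<omega>' x. \<omega>' > 0 \<Longrightarrow> x \<in> I \<Longrightarrow> \<omega>' * (x - a) ^ (r + 1) \<le> \<omega> * (b - a) ^ (r + 1) \<Longrightarrow>
    norm (J \<mu> \<omega>' x) \<le> C * (\<omega>' powr Re \<mu> * (x - a) powr ((real r + 1) * Re \<mu>))"
    using J_small by blast
  show thesis
  proof (rule that)
    fix x assume x: "x \<in> I"
    have "\<omega> * (x - a) ^ (r + 1) \<le> \<omega> * (b - a) ^ (r + 1)"
      using x w by (intro mult_left_mono power_mono) auto
    from C(2)[OF w x this] have j: "norm (J \<mu> \<omega> x) \<le> C * (\<omega> powr Re \<mu> * (x - a) powr ((real r + 1) * Re \<mu>))" .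
    have "norm (of_real ((x - a) powr p) * S x * J \<mu> \<omega> x)
      \<le> (x - a) powr p * B * (C * (\<omega> powr Re \<mu> * (x - a) powr ((real r + 1) * Re \<mu>)))"
      unfolding norm_mult norm_of_real using B(1) B(2)[OF x] by (intro mult_mono j) auto
    then show "norm (of_real ((x - a) powr p) * S x * J \<mu> \<omega> x) \<le> B * C * \<omega> powr Re \<mu> * (x - a) powr (p + (real r + 1) * Re \<mu>)"
      by (simp add: powr_add mult_ac)
  qed
qed

text \<open>On (a, b] the integrand is continuous, hence measurable, and is dominated by an
  integrable power of \<open>x - a\<close>.\<close>

lemma powr_J_integrable:
  assumes S: "bsmooth S" and w: "\<omega> > 0" and p: "p + (real r + 1) * Re \<mu> > -1"
  shows "(\<lambda>x. of_real ((x - a) powr p) * S x * J \<mu> \<omega> x) integrable_on {a..b}"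
proof -
  obtain C where C: "\<And>x. x \<in> I \<Longrightarrow> norm (of_real ((x - a) powr p) * S x * J \<mu> \<omega> x) \<le> C * (x - a) powr (p + (real r + 1) * Re \<mu>)"
    using powr_J_bound[OF S w] by blast
  have "(\<lambda>x. (x - a) powr (p + (real r + 1) * Re \<mu>)) integrable_on {a..b}"
    using has_integral_powr_shift[of a a b "p + (real r + 1) * Re \<mu>"] p ab by (auto intro: has_integral_integrable)
  then have g: "(\<lambda>x. C * (x - a) powr (p + (real r + 1) * Re \<mu>)) integrable_on {a..b}"
    by (rule integrable_on_mult_right)
  have "(\<lambda>x. of_real ((x - a) powr p) * S x * J \<mu> \<omega> x) integrable_on I"
  proof (rule measurable_bounded_by_integrable_imp_integrable[OF _ _ C])
    show "(\<lambda>x. of_real ((x - a) powr p) * S x * J \<mu> \<omega> x) \<in> borel_measurable (lebesgue_on I)"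
      by (intro continuous_imp_measurable_on_sets_lebesgue continuous_intros continuous_bsmooth S continuous_J w) auto
    show "(\<lambda>x. C * (x - a) powr (p + (real r + 1) * Re \<mu>)) integrable_on I"
      by (rule integrable_spike_set[OF g]) (auto intro: negligible_subset[OF negligible_sing[of a]])
  qed auto
  then show ?thesis
    by (rule integrable_spike_set) (auto intro: negligible_subset[OF negligible_sing[of a]])
qed


lemma bsmooth_J_integrable:
  assumes S: "bsmooth S" and w: "\<omega> > 0" and \<mu>: "(real r + 1) * Re \<mu> > - 1"
  shows "(\<lambda>x. S x * J \<mu> \<omega> x) integrable_on {a..b}"
proof (rule integrable_spike_set)
  have "(\<lambda>x. of_real ((x - a) powr 0) * S x * J \<mu> \<omega> x) integrable_on {a..b}"
    by (rule powr_J_integrable[OF S w]) (use \<mu> in simp)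
  then have "(\<lambda>x. of_real ((x - a) powr 0) * S x * J \<mu> \<omega> x) integrable_on I"
    by (rule integrable_spike_set) (auto intro: negligible_subset[OF negligible_sing[of a]])
  then show "(\<lambda>x. S x * J \<mu> \<omega> x) integrable_on I" by (rule integrable_eq) auto
qed (auto intro: negligible_subset[OF negligible_sing[of a]])

text \<open>Both boundary terms vanish: at \<open>b\<close> by \<open>U b = 0\<close>, at
  \<open>a\<close> because the product decays like \<open>x - a\<close> to the power k + (r+1)
  Re(mu+1), which is positive.\<close>

lemma J_integral_by_parts:
  assumes U: "bsmooth U" "U b = 0" and \<mu>: "(real r + 1) * Re \<mu> > - 1" and w: "\<omega> > 0" and k: "k \<ge> 1"
  shows "of_real \<omega> * integral {a..b} (\<lambda>x. of_real ((x - a) powr (k + real r)) * (U x * of_real (G1 x)) * J \<mu> \<omega> x)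
    = integral {a..b} (\<lambda>x. of_real ((x - a) powr (k - 1)) * ibp_coeff \<mu> k U x * J (\<mu> + 1) \<omega> x)"
proof -
  let ?F = "\<lambda>x. of_real ((x - a) powr k) * U x * J (\<mu> + 1) \<omega> x"
  let ?h = "\<lambda>x. of_real ((x - a) powr (k + real r)) * (U x * of_real (G1 x)) * J \<mu> \<omega> x"
  let ?e = "\<lambda>x. of_real ((x - a) powr (k - 1)) * ibp_coeff \<mu> k U x * J (\<mu> + 1) \<omega> x"
  have q: "k + (real r + 1) * Re (\<mu> + 1) > 0" using k \<mu> by (simp add: algebra_simps)
  have hi: "?h integrable_on {a..b}"
    by (rule powr_J_integrable) (use U w bG1 k \<mu> in \<open>auto intro!: bsmooth_mult bsmooth_of_real simp: algebra_simps\<close>)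
  have ei: "?e integrable_on {a..b}"
    by (rule powr_J_integrable) (use U w q in \<open>auto intro!: bsmooth_ibp_coeff\<close>)
  have "((\<lambda>x. of_real \<omega> * ?h x - ?e x) has_integral (?F b - ?F a)) {a..b}"
  proof (rule fundamental_theorem_of_calculus_interior)
    fix x assume x: "x \<in> {a<..<b}"
    then have "at x within I = at x" by (intro at_within_open_subset[of x "{a<..<b}" I]) auto
    then show "(?F has_vector_derivative of_real \<omega> * ?h x - ?e x) (at x)"
      using J_product_deriv[OF U(1) w, of x k \<mu>] x by auto
  next
    have lim: "(?F \<longlongrightarrow> 0) (at_right a)"
    proof -
      obtain C where C: "\<And>x. x \<in> I \<Longrightarrow> norm (?F x) \<le> C * (x - a) powr (k + (real r + 1) * Re (\<mu> + 1))"
        using powr_J_bound[OF U(1) w] by blast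
      show ?thesis by (rule tendsto_zero_bound[OF ab C q])
    qed
    have "continuous_on I ?F"
      by (intro continuous_intros continuous_bsmooth U continuous_J w) auto
    then have "continuous (at x within {a..b}) ?F" if "x \<in> {a..b}" for x
    \<comment> \<open>At \<open>a\<close> the product has the value 0, since
      \<open>0 powr k = 0\<close>, and this agrees with its limit; hence it is continuous on the
      closed interval.\<close>
    proof (cases "x = a")
      case True
      have "at a within {a..b} = at_right a" using ab by (rule at_within_Icc_at_right)
      then show ?thesis using lim True by (simp add: continuous_within)
    next
      case False
      have "at x within {a..b} = at x within I"
        by (rule at_within_nhd[of x "{a<..}"]) (use False that in auto)
      then show ?thesis using \<open>continuous_on I ?F\<close> that False
        by (auto simp: continuous_on_eq_continuous_within)
    qed
    then show "continuous_on {a..b} ?F" by (simp add: continuous_on_eq_continuous_within)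
  qed (use ab in simp)
  then have "((\<lambda>x. of_real \<omega> * ?h x - ?e x) has_integral 0) {a..b}" using U(2) by simp
  moreover have "((\<lambda>x. of_real \<omega> * ?h x - ?e x) has_integral (of_real \<omega> * integral {a..b} ?h - integral {a..b} ?e)) {a..b}"
    by (intro has_integral_diff has_integral_mult_right integrable_integral hi ei)
  ultimately have "0 = of_real \<omega> * integral {a..b} ?h - integral {a..b} ?e" by (rule has_integral_unique)
  then show ?thesis by (rule right_minus_eq[THEN iffD1, OF sym])
qed

text \<open>Without decay at \<open>a\<close> the integral is split at the scale \<open>\<delta>\<close> on which \<open>\<omega> \<gamma>\<close> is of order one;
  a further integration by parts to the right of \<open>a + \<delta>\<close> makes mere boundedness of the Bessel
  functions sufficient, even for \<open>r = 1\<close>.\<close>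
lemma J_integral_base:
  assumes S: "bsmooth S" and \<mu>: "(real r + 1) * Re \<mu> > - 1"
  shows "\<exists>C. \<forall>\<omega>>0. \<omega> * (b - a) ^ (r + 1) \<ge> 1 \<longrightarrow>
    norm (integral {a..b} (\<lambda>x. S x * J \<mu> \<omega> x)) \<le> C * \<omega> powr (- (1 / (real r + 1)))"
proof -
  \<comment> \<open>Chosen so that \<open>S\<close> equals (x-a)^(k+r) \<open>U\<close>
    \<open>G1\<close> on (a, b] for \<open>k = - real r\<close>, the form produced by
    \<open>J_product_deriv\<close>.\<close>
  define U where "U x = S x * of_real (inverse (G1 x))" for x
  have U: "bsmooth U" unfolding U_def by (intro bsmooth_mult S bsmooth_of_real bsmooth_inverse_G1)
  obtain BS where BS: "BS > 0" "\<And>x. x \<in> I \<Longrightarrow> norm (S x) \<le> BS" using bsmooth_boundedE[OF S] by blast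
  obtain BU where BU: "BU > 0" "\<And>x. x \<in> I \<Longrightarrow> norm (U x) \<le> BU" using bsmooth_boundedE[OF U] by blast
  obtain BE where BE: "BE > 0" "\<And>x. x \<in> I \<Longrightarrow> norm (ibp_coeff \<mu> (- real r) U x) \<le> BE"
    using bsmooth_boundedE[OF bsmooth_ibp_coeff[OF U, of \<mu> "- real r"]] by blast
  obtain CL where CL: "CL > 0" "\<And>\<omega> x. \<omega> > 0 \<Longrightarrow> x \<in> I \<Longrightarrow> \<omega> * (x - a) ^ (r + 1) \<ge> 1 \<Longrightarrow> norm (J (\<mu> + 1) \<omega> x) \<le> CL"
    using J_large[of "\<mu> + 1"] by blast
  obtain CS where CS: "CS > 0" "\<And>\<omega> x. \<omega> > 0 \<Longrightarrow> x \<in> I \<Longrightarrow> \<omega> * (x - a) ^ (r + 1) \<le> 1 \<Longrightarrow>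
    norm (J \<mu> \<omega> x) \<le> CS * (\<omega> powr Re \<mu> * (x - a) powr ((real r + 1) * Re \<mu>))"
    using J_small[of 1 \<mu>] by blast
  define q where "q = (real r + 1) * Re \<mu>"
  have q: "q > -1" using \<mu> by (simp add: q_def)
  have rp: "real r > 0" using r1 by simp
  define C where "C = BS * CS / (q + 1) + (2 * BU * CL + BE * CL / real r)"
  have "norm (integral {a..b} (\<lambda>x. S x * J \<mu> \<omega> x)) \<le> C * \<omega> powr (- (1 / (real r + 1)))"
    if w: "\<omega> > 0" and wb: "\<omega> * (b - a) ^ (r + 1) \<ge> 1" for \<omega>
  proof -
    define \<delta> where "\<delta> = \<omega> powr (- (1 / (real r + 1)))"
    have d0: "\<delta> > 0" using w by (simp add: \<delta>_def)
    have dpow: "\<delta> powr s = \<omega> powr (- (s / (real r + 1)))" for s by (simp add: \<delta>_def powr_powr)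
    have dr: "\<delta> ^ (r + 1) = 1 / \<omega>"
    proof -
      have "\<delta> ^ (r + 1) = \<delta> powr real (r + 1)" using powr_realpow[OF d0, of "r + 1"] by simp
      also have "\<dots> = \<omega> powr (- 1)" unfolding dpow by (simp add: add.commute)
      finally show ?thesis using w by (simp add: powr_minus_divide)
    qed
    have db: "\<delta> \<le> b - a"
    proof (rule ccontr)
      assume "\<not> \<delta> \<le> b - a"
      then have "(b - a) ^ (r + 1) < \<delta> ^ (r + 1)" using ab by (intro power_strict_mono) auto
      then have "\<omega> * (b - a) ^ (r + 1) < \<omega> * (1 / \<omega>)" unfolding dr using w by (intro mult_strict_left_mono)
      then show False using wb w by simp
    qed
    let ?h = "\<lambda>x. S x * J \<mu> \<omega> x"
    let ?e = "\<lambda>x. of_real ((x - a) powr (- real r - 1)) * ibp_coeff \<mu> (- real r) U x * J (\<mu> + 1) \<omega> x"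
    let ?F = "\<lambda>x. of_real ((x - a) powr (- real r)) * U x * J (\<mu> + 1) \<omega> x"
    let ?c = "a + \<delta>"
    have hi: "?h integrable_on {a..b}" by (rule bsmooth_J_integrable[OF S w \<mu>])
    have hi2: "?h integrable_on {?c..b}" by (rule integrable_on_subinterval[OF hi]) (use d0 in auto)
    have hi1: "?h integrable_on {a..?c}" by (rule integrable_on_subinterval[OF hi]) (use db in auto)
    \<comment> \<open>The higher order \<mu> + 1 gains exactly r+1 powers of \<open>x - a\<close>,
      which offsets the exponent -r-1 and restores the condition on \<mu>.\<close>
    have "?e integrable_on {a..b}"
      by (rule powr_J_integrable[OF bsmooth_ibp_coeff[OF U] w]) (use \<mu> in \<open>simp add: algebra_simps\<close>)
    then have ei: "?e integrable_on {?c..b}" by (rule integrable_on_subinterval) (use d0 in auto)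
    have wt: "\<omega> * (x - a) ^ (r + 1) \<ge> 1" if "x \<ge> ?c" for x
    proof -
      have "\<omega> * \<delta> ^ (r + 1) \<le> \<omega> * (x - a) ^ (r + 1)"
        using that d0 w by (intro mult_left_mono power_mono) auto
      then show ?thesis unfolding dr using w by simp
    qed
    have split: "integral {a..b} ?h = integral {a..?c} ?h + integral {?c..b} ?h"
      by (rule Henstock_Kurzweil_Integration.integral_combine[symmetric, OF _ _ hi]) (use d0 db in auto)
    have part1: "norm (integral {a..?c} ?h) \<le> BS * CS / (q + 1) * \<delta>"
    proof -
      have p: "((\<lambda>x. (x - a) powr q) has_integral \<delta> powr (q + 1) / (q + 1)) {a..?c}"
        using has_integral_powr_shift[of a a ?c q] d0 q by simp
      have "norm (integral {a<..?c} ?h) \<le> integral {a<..?c} (\<lambda>x. BS * CS * \<omega> powr Re \<mu> * (x - a) powr q)"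
      proof (rule integral_norm_bound_integral)
        show "?h integrable_on {a<..?c}"
          by (rule integrable_spike_set[OF hi1]) (auto intro: negligible_subset[OF negligible_sing[of a]])
        have "(\<lambda>x. BS * CS * \<omega> powr Re \<mu> * (x - a) powr q) integrable_on {a..?c}"
          by (rule integrable_on_mult_right) (rule has_integral_integrable[OF p])
        then show "(\<lambda>x. BS * CS * \<omega> powr Re \<mu> * (x - a) powr q) integrable_on {a<..?c}"
          by (rule integrable_spike_set) (auto intro: negligible_subset[OF negligible_sing[of a]])
        fix x assume x: "x \<in> {a<..?c}"
        then have xI: "x \<in> I" using db by auto
        have "\<omega> * (x - a) ^ (r + 1) \<le> \<omega> * \<delta> ^ (r + 1)"
          using x w by (intro mult_left_mono power_mono) auto
        then have "\<omega> * (x - a) ^ (r + 1) \<le> 1" unfolding dr using w by simp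
        from CS(2)[OF w xI this] have "norm (J \<mu> \<omega> x) \<le> CS * (\<omega> powr Re \<mu> * (x - a) powr q)"
          by (simp add: q_def)
        then have "norm (?h x) \<le> BS * (CS * (\<omega> powr Re \<mu> * (x - a) powr q))"
          unfolding norm_mult using BS(1) BS(2)[OF xI] by (intro mult_mono) auto
        then show "norm (?h x) \<le> BS * CS * \<omega> powr Re \<mu> * (x - a) powr q" by (simp add: mult_ac)
      qed
      also have "integral {a<..?c} (\<lambda>x. BS * CS * \<omega> powr Re \<mu> * (x - a) powr q)
        = integral {a..?c} (\<lambda>x. BS * CS * \<omega> powr Re \<mu> * (x - a) powr q)"
        by (rule integral_subset_negligible) (auto intro: negligible_subset[OF negligible_sing[of a]])
      also have "\<dots> = BS * CS / (q + 1) * (\<omega> powr Re \<mu> * \<delta> powr (q + 1))"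
        by (subst integral_unique[OF has_integral_mult_right[OF p]]) (simp add: mult_ac)
      \<comment> \<open>The choice of \<delta> gives
        \<open>\<delta> powr q = \<omega> powr (- Re \<mu>)\<close>, so the singular size of the
        Bessel function is balanced and only the length \<delta> remains.\<close>
      also have "\<omega> powr Re \<mu> * \<delta> powr (q + 1) = \<delta>"
      proof -
        have "\<delta> powr q = \<omega> powr (- Re \<mu>)" unfolding dpow q_def by simp
        then have "\<delta> powr (q + 1) = \<omega> powr (- Re \<mu>) * \<delta>" using d0 by (simp add: powr_add)
        then show ?thesis using w by (simp add: powr_minus)
      qed
      also have "integral {a<..?c} ?h = integral {a..?c} ?h"
        by (rule integral_subset_negligible) (auto intro: negligible_subset[OF negligible_sing[of a]])
      finally show ?thesis .
    qed
    \<comment> \<open>One integration by parts with \<open>k = - real r\<close>. Boundary terms and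
      the integral of (x-a)^(-r-1) are all of size \<delta>^(-r), which the factor 1/\<omega> turns
      into \<delta>.\<close>
    have part2: "norm (integral {?c..b} ?h) \<le> (2 * BU * CL + BE * CL / real r) * \<delta>"
    proof -
      have "((\<lambda>x. of_real \<omega> * ?h x - ?e x) has_integral (?F b - ?F ?c)) {?c..b}"
      proof (rule fundamental_theorem_of_calculus)
        fix x assume x: "x \<in> {?c..b}"
        then have xI: "x \<in> I" using d0 by auto
        have "((x - a) powr (- real r + real r)) = 1" using xI by simp
        moreover have "U x * of_real (G1 x) = S x" using G1_pos[OF xI] by (simp add: U_def)
        ultimately have "(?F has_vector_derivative of_real \<omega> * ?h x - ?e x) (at x within I)"
          using J_product_deriv[OF U w xI, of "- real r" \<mu>] by simp
        then show "(?F has_vector_derivative of_real \<omega> * ?h x - ?e x) (at x within {?c..b})"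
          by (rule has_vector_derivative_within_subset) (use d0 in auto)
      qed (use db in simp)
      moreover have "((\<lambda>x. of_real \<omega> * ?h x - ?e x) has_integral (of_real \<omega> * integral {?c..b} ?h - integral {?c..b} ?e)) {?c..b}"
        by (intro has_integral_diff has_integral_mult_right integrable_integral hi2 ei)
      ultimately have "?F b - ?F ?c = of_real \<omega> * integral {?c..b} ?h - integral {?c..b} ?e"
        by (rule has_integral_unique)
      then have eq: "of_real \<omega> * integral {?c..b} ?h = ?F b - ?F ?c + integral {?c..b} ?e" by (simp only: diff_add_cancel)
      have F: "norm (?F x) \<le> \<delta> powr (- real r) * BU * CL" if x: "x \<in> {?c..b}" for x
      proof -
        have xI: "x \<in> I" using d0 x by auto
        have "(x - a) powr (- real r) \<le> \<delta> powr (- real r)"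
          using x d0 rp by (intro powr_mono2') auto
        then show ?thesis unfolding norm_mult norm_of_real
          using BU(1) BU(2)[OF xI] CL(2)[OF w xI wt] x by (intro mult_mono) auto
      qed
      have "norm (integral {?c..b} ?e) \<le> integral {?c..b} (\<lambda>x. BE * CL * (x - a) powr (- real r - 1))"
      proof (rule integral_norm_bound_integral[OF ei])
        have "(\<lambda>x. (x - a) powr (- real r - 1)) integrable_on {?c..b}"
          using has_integral_powr_shift[of a ?c b "- real r - 1"] d0 db rp by (auto dest: has_integral_integrable)
        then show "(\<lambda>x. BE * CL * (x - a) powr (- real r - 1)) integrable_on {?c..b}"
          by (rule integrable_on_mult_right)
        fix x assume x: "x \<in> {?c..b}"
        then have xI: "x \<in> I" using d0 by auto
        have "norm (?e x) \<le> (x - a) powr (- real r - 1) * BE * CL"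
          unfolding norm_mult norm_of_real
          using BE(1) BE(2)[OF xI] CL(2)[OF w xI wt] x by (intro mult_mono) auto
        then show "norm (?e x) \<le> BE * CL * (x - a) powr (- real r - 1)" by (simp add: mult_ac)
      qed
      also have "\<dots> = BE * CL * (((b - a) powr (- real r) - \<delta> powr (- real r)) / (- real r))"
        using has_integral_mult_right[OF has_integral_powr_shift[of a ?c b "- real r - 1"], of "BE * CL"] d0 db rp
        by (intro integral_unique) auto
      also have "((b - a) powr (- real r) - \<delta> powr (- real r)) / (- real r) \<le> \<delta> powr (- real r) / real r"
        using rp by (simp add: field_simps)
      finally have e: "norm (integral {?c..b} ?e) \<le> BE * CL * (\<delta> powr (- real r) / real r)"
        using BE(1) CL(1) by (simp add: mult_left_mono)
      have "\<omega> * norm (integral {?c..b} ?h) = norm (?F b - ?F ?c + integral {?c..b} ?e)"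
        unfolding eq[symmetric] norm_mult using w by simp
      also have "\<dots> \<le> norm (?F b) + norm (?F ?c) + norm (integral {?c..b} ?e)"
        using norm_triangle_ineq[of "?F b - ?F ?c" "integral {?c..b} ?e"] norm_triangle_ineq4[of "?F b" "?F ?c"] by linarith
      also have "\<dots> \<le> \<delta> powr (- real r) * BU * CL + \<delta> powr (- real r) * BU * CL + BE * CL * (\<delta> powr (- real r) / real r)"
        by (intro add_mono F e) (use db d0 in auto)
      also have "\<dots> = (2 * BU * CL + BE * CL / real r) * \<delta> powr (- real r)" by (simp add: algebra_simps)
      \<comment> \<open>From \<open>dr\<close>: \<delta>^(-r) is \<delta> divided by \<delta>^(r+1)
        = 1/\<omega>.\<close>
      also have "\<delta> powr (- real r) = \<omega> * \<delta>"
      proof -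
        have "\<delta> powr (- real r) = 1 / \<delta> ^ r"
          unfolding powr_minus_divide by (subst powr_realpow[OF d0]) simp
        also have "\<dots> = \<omega> * \<delta>"
          using dr w d0 by (subst divide_eq_eq) (simp add: field_simps)
        finally show ?thesis .
      qed
      finally have "\<omega> * norm (integral {?c..b} ?h) \<le> \<omega> * ((2 * BU * CL + BE * CL / real r) * \<delta>)"
        by (simp add: mult_ac)
      then show ?thesis using w by simp
    qed
    have "norm (integral {a..b} ?h) \<le> C * \<delta>"
      unfolding split C_def distrib_right[of "BS * CS / (q + 1)"] by (rule norm_triangle_mono[OF part1 part2])
    then show ?thesis unfolding \<delta>_def .
  qed
  then show ?thesis by (intro exI[of _ C] allI impI)
qed

text \<open>Induction over all amplitudes and orders at once: a step replaces \<open>S\<close> by an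
  \<open>ibp_coeff\<close> and \<mu> by \<mu> + 1, and the condition on Re \<mu> only
  improves.\<close>

lemma J_integral_decay:
  assumes "bsmooth S" "flat m S" "(real r + 1) * Re \<mu> > - 1"
  shows "\<exists>C. \<forall>\<omega>>0. \<omega> * (b - a) ^ (r + 1) \<ge> 1 \<longrightarrow>
    norm (integral {a..b} (\<lambda>x. of_real ((x - a) powr (real m * (real r + 1))) * S x * J \<mu> \<omega> x))
      \<le> C * \<omega> powr (- (real m + 1 / (real r + 1)))"
  using assms
proof (induction m arbitrary: S \<mu>)
  case 0
  \<comment> \<open>The power with exponent 0 is 1 except at \<open>a\<close>, where
    \<open>0 powr 0 = 0\<close>; one point does not affect the integral.\<close>
  have "integral {a..b} (\<lambda>x. of_real ((x - a) powr (real 0 * (real r + 1))) * S x * J \<mu> \<omega> x)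
    = integral {a..b} (\<lambda>x. S x * J \<mu> \<omega> x)" for \<omega>
    by (rule integral_spike[of "{a}"]) auto
  then show ?case using J_integral_base[OF 0(1,3)] by simp
next
  case (Suc m)
  define U where "U x = S x * of_real (inverse (G1 x))" for x
  have U: "bsmooth U" unfolding U_def by (intro bsmooth_mult Suc.prems bsmooth_of_real bsmooth_inverse_G1)
  have fU: "flat (Suc m) U"
    unfolding U_def by (intro flat_mult Suc.prems bsmooth_of_real bsmooth_inverse_G1)
  \<comment> \<open>With this value \<open>k + r\<close> is the current exponent (m+1)(r+1) and
    \<open>k - 1\<close> is the exponent m(r+1) of the induction hypothesis.\<close>
  define k where "k = real m * (real r + 1) + 1"
  have k: "k \<ge> 1" by (simp add: k_def)
  have "(real r + 1) * Re (\<mu> + 1) > - 1" using Suc.prems(3) by (simp add: algebra_simps)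
  from Suc.IH[OF bsmooth_ibp_coeff[OF U] flat_ibp_coeff[OF U fU] this, of \<mu> k]
  obtain C where C: "\<And>\<omega>. \<omega> > 0 \<Longrightarrow> \<omega> * (b - a) ^ (r + 1) \<ge> 1 \<Longrightarrow>
    norm (integral {a..b} (\<lambda>x. of_real ((x - a) powr (k - 1)) * ibp_coeff \<mu> k U x * J (\<mu> + 1) \<omega> x))
      \<le> C * \<omega> powr (- (real m + 1 / (real r + 1)))"
    by (auto simp: k_def)
  show ?case
  proof (intro exI allI impI)
    fix \<omega> assume w: "\<omega> > 0" and wb: "\<omega> * (b - a) ^ (r + 1) \<ge> 1"
    have e1: "integral {a..b} (\<lambda>x. of_real ((x - a) powr (real (Suc m) * (real r + 1))) * S x * J \<mu> \<omega> x)
       = integral {a..b} (\<lambda>x. of_real ((x - a) powr (k + real r)) * (U x * of_real (G1 x)) * J \<mu> \<omega> x)"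
    proof (rule integral_spike[of "{a}"])
      fix x assume "x \<in> {a..b} - {a}"
      then have "G1 x > 0" using G1_pos[of x] by auto
      moreover have "k + real r = real (Suc m) * (real r + 1)" by (simp add: k_def algebra_simps)
      ultimately show "of_real ((x - a) powr (k + real r)) * (U x * of_real (G1 x)) * J \<mu> \<omega> x
        = of_real ((x - a) powr (real (Suc m) * (real r + 1))) * S x * J \<mu> \<omega> x"
        by (simp add: U_def)
    qed auto
    have e2: "of_real \<omega> * integral {a..b} (\<lambda>x. of_real ((x - a) powr (k + real r)) * (U x * of_real (G1 x)) * J \<mu> \<omega> x)
      = integral {a..b} (\<lambda>x. of_real ((x - a) powr (k - 1)) * ibp_coeff \<mu> k U x * J (\<mu> + 1) \<omega> x)"
      by (rule J_integral_by_parts[OF U _ Suc.prems(3) w k]) (use fU in \<open>simp add: flat_Suc\<close>)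
    have "norm (integral {a..b} (\<lambda>x. of_real ((x - a) powr (k + real r)) * (U x * of_real (G1 x)) * J \<mu> \<omega> x)) * \<omega>
      \<le> C * \<omega> powr (- (real m + 1 / (real r + 1)))"
      using C[OF w wb] w unfolding e2[symmetric] norm_mult norm_of_real by (simp add: mult.commute)
    then have "norm (integral {a..b} (\<lambda>x. of_real ((x - a) powr (real (Suc m) * (real r + 1))) * S x * J \<mu> \<omega> x))
      \<le> C * \<omega> powr (- (real m + 1 / (real r + 1))) / \<omega>"
      unfolding e1 pos_le_divide_eq[OF w] .
    also have "\<dots> = C * \<omega> powr (- (real (Suc m) + 1 / (real r + 1)))"
    proof -
      have "- (real (Suc m) + 1 / (real r + 1)) = - (real m + 1 / (real r + 1)) - 1" by simp
      then have "\<omega> powr (- (real (Suc m) + 1 / (real r + 1))) = \<omega> powr (- (real m + 1 / (real r + 1))) / \<omega>"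
        using w by (simp only: powr_diff powr_one less_imp_le)
      then show ?thesis by (simp only: times_divide_eq_right)
    qed
    finally show "norm (integral {a..b} (\<lambda>x. of_real ((x - a) powr (real (Suc m) * (real r + 1))) * S x * J \<mu> \<omega> x))
      \<le> C * \<omega> powr (- (real (Suc m) + 1 / (real r + 1)))" .
  qed
qed

end

section \<open>From the hypotheses on f and g to the model phase\<close>

lemma nonvanishing_sign:
  fixes h :: "real \<Rightarrow> real"
  assumes "continuous_on {a..b} h" "\<And>x. x \<in> {a..b} \<Longrightarrow> h x \<noteq> 0"
  shows "(\<forall>x\<in>{a..b}. h x > 0) \<or> (\<forall>x\<in>{a..b}. h x < 0)"
proof (rule ccontr)
  assume "\<not> ?thesis"
  then obtain x y where xy: "x \<in> {a..b}" "y \<in> {a..b}" "h x < 0" "h y > 0"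
    using assms(2) by (metis linorder_neqE_linordered_idom)
  have "connected (h ` {a..b})" by (rule connected_continuous_image[OF assms(1)]) simp
  then have "0 \<in> h ` {a..b}"
    using connectedD_interval[of "h ` {a..b}" "h x" "h y" 0] xy by auto
  then show False using assms(2) by auto
qed

text \<open>Integrates the lower bound for \<open>h'\<close> from \<open>a\<close>. Iterated
  downwards from the derivative of order r+1, it bounds |g'| and |g| below by powers of
  \<open>x - a\<close>.\<close>

lemma growth_from_deriv:
  fixes h h' :: "real \<Rightarrow> real"
  assumes "\<And>x. x \<in> {a..b} \<Longrightarrow> (h has_real_derivative h' x) (at x within {a..b})"
    and "h a = 0" and "\<And>x. x \<in> {a..b} \<Longrightarrow> h' x \<ge> k * (x - a) ^ i" and x: "x \<in> {a..b}"
  shows "h x \<ge> k / (real i + 1) * (x - a) ^ Suc i"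
proof -
  let ?P = "\<lambda>x. h x - k / (real i + 1) * (x - a) ^ Suc i"
  have "((\<lambda>x. h' x - k * (x - a) ^ i) has_integral (?P x - ?P a)) {a..x}"
  proof (rule fundamental_theorem_of_calculus)
    fix y assume y: "y \<in> {a..x}"
    have "((\<lambda>x. x - a) has_real_derivative 1) (at y within {a..b})" by (auto intro!: derivative_eq_intros)
    from DERIV_cmult[OF DERIV_power[OF this, of "Suc i"], of "k / (real i + 1)"]
    have "((\<lambda>x. k / (real i + 1) * (x - a) ^ Suc i) has_real_derivative k * (y - a) ^ i) (at y within {a..b})"
      by (rule DERIV_cong) (simp add: add.commute)
    from DERIV_diff[OF assms(1)[of y] this]
    have "(?P has_real_derivative h' y - k * (y - a) ^ i) (at y within {a..b})" using x y by simp
    then show "(?P has_vector_derivative h' y - k * (y - a) ^ i) (at y within {a..x})"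
      unfolding has_real_derivative_iff_has_vector_derivative[symmetric]
      by (rule DERIV_subset) (use x in auto)
  qed (use x in simp)
  then have "0 \<le> ?P x - ?P a"
    by (rule has_integral_nonneg) (use assms(3) x in auto)
  then show ?thesis using assms(2) by simp
qed

lemma smooth_on_deriv:
  "smooth_on S f \<Longrightarrow> x \<in> S \<Longrightarrow> (nderiv j S f has_real_derivative nderiv (Suc j) S f x) (at x within S)"
  unfolding smooth_on_def by blast

lemma smooth_on_limit:
  assumes "a < b" "smooth_on {a..b} f"
  shows "(nderiv j {a..b} f \<longlongrightarrow> nderiv j {a..b} f a) (at_right a)"
proof -
  have "continuous (at a within {a..b}) (nderiv j {a..b} f)"
    using DERIV_isCont has_field_derivative_imp_has_derivative has_derivative_continuous
      smooth_on_deriv[OF assms(2), of a j] assms(1) by fastforce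
  then show ?thesis using at_within_Icc_at_right[OF assms(1)] by (simp add: continuous_within)
qed

text \<open>Interpolation at \<open>a\<close> is stated through limits from the right because the
  value of \<open>phihat\<close> at \<open>a\<close> is 0 by convention. Derivatives of the
  interpolant are taken within (a, b], hence one-sided at \<open>b\<close>. Derivative orders are
  counted from 0.\<close>

theorem theorem3p7:
  fixes r m d n :: nat and \<nu> :: complex and a b :: real
    and f g :: "real \<Rightarrow> real"
    and xs :: "nat \<Rightarrow> real" and ms :: "nat \<Rightarrow> nat" and c :: "nat \<Rightarrow> real"
  assumes r: "r \<ge> 1"
    and nu: "Re \<nu> > - 1 / (real r + 1)"
    and ab: "a < b"
    and f_smooth: "smooth_on {a..b} f"
    and g_smooth: "smooth_on {a..b} g"
    and g_a: "g a = 0"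
    and g_derivs_a: "\<And>j. j \<in> {1..r} \<Longrightarrow> nderiv j {a..b} g a = 0"
    and g_r1: "\<And>x. x \<in> {a..b} \<Longrightarrow> nderiv (Suc r) {a..b} g x \<noteq> 0"
    and g_nz: "\<And>x. x \<in> {a<..b} \<Longrightarrow> g x \<noteq> 0"
    and g'_nz: "\<And>x. x \<in> {a<..b} \<Longrightarrow> nderiv 1 {a..b} g x \<noteq> 0"
    and nodes0: "xs 0 = a" and nodesd: "xs d = b"
    and nodes_mono: "\<And>k. k < d \<Longrightarrow> xs k < xs (Suc k)"
    and mult_pos: "\<And>k. k \<le> d \<Longrightarrow> ms k \<ge> 1"
    and n_def: "n = (\<Sum>k\<le>d. ms k)"
    and interp_a: "\<And>j. j < ms 0 \<Longrightarrow>
        ((\<lambda>x. nderiv j {a<..b} (\<lambda>y. \<Sum>i<n. c i * phihat r a b g i y) x)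
           \<longlongrightarrow> nderiv j {a..b} f a) (at_right a)"
    and interp: "\<And>k j. 1 \<le> k \<Longrightarrow> k \<le> d \<Longrightarrow> j < ms k \<Longrightarrow>
        nderiv j {a<..b} (\<lambda>y. \<Sum>i<n. c i * phihat r a b g i y) (xs k) = nderiv j {a..b} f (xs k)"
    and m: "m \<ge> 1" and m_d: "ms d \<ge> m" and m_0: "ms 0 \<ge> m * (r + 1)"
  shows "(\<lambda>\<omega>. bessel_int \<nu> a b g f \<omega>
              - bessel_int \<nu> a b g (\<lambda>y. \<Sum>i<n. c i * phihat r a b g i y) \<omega>)
         \<in> O[at_top](\<lambda>\<omega>. complex_of_real (\<omega> powr (- (real m + 1 / (real r + 1)))))"
proof -
  interpret half_open a b by standard (rule ab)
  define D where "D j = nderiv j {a..b} g" for j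
  \<comment> \<open>The sign of the derivative of g of order r+1, selected by the same test as in
    \<open>phihat\<close>, so that both branches there read as powers of \<open>s * g x\<close>. As
    this derivative has no zero, failure of the test means negativity everywhere.\<close>
  define s :: real where "s = (if \<forall>y\<in>{a..b}. nderiv (Suc r) {a..b} g y > 0 then 1 else - 1)"
  have D0: "D 0 = g" by (simp add: D_def)
  have dD: "(D j has_real_derivative D (Suc j) x) (at x within {a..b})" if "x \<in> {a..b}" for j x
    unfolding D_def by (rule smooth_on_deriv[OF g_smooth that])
  have Da: "D j a = 0" if "j \<le> r" for j
    using g_derivs_a[of j] g_a that unfolding D_def by (cases j) auto
  have bD: "bsmooth (D j)" for j unfolding D_def by (rule smooth_on_bsmooth[OF g_smooth])
  have vdD: "(vd ^^ j) g x = D j x" if "x \<in> I" for j x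
    unfolding D_def by (rule vd_nderiv[OF g_smooth that])
  have cD: "continuous_on {a..b} (D j)" for j
    using dD DERIV_continuous_on by blast
  have ss: "s * s = 1" "\<bar>s\<bar> = 1" by (auto simp: s_def)

  \<comment> \<open>Sign and lower bounds of g and its derivatives\<close>
  have spos: "s * D (Suc r) x > 0" if "x \<in> {a..b}" for x
    using nonvanishing_sign[OF cD[of "Suc r"]] g_r1 that by (auto simp: s_def D_def[symmetric])
  obtain k0 where k0: "k0 > 0" "\<And>x. x \<in> {a..b} \<Longrightarrow> s * D (Suc r) x \<ge> k0"
  proof -
    have "continuous_on {a..b} (\<lambda>x. s * D (Suc r) x)" by (intro continuous_intros cD)
    then obtain y where "y \<in> {a..b}" "\<forall>x\<in>{a..b}. s * D (Suc r) y \<le> s * D (Suc r) x"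
      using continuous_attains_inf[of "{a..b}" "\<lambda>x. s * D (Suc r) x"] ab by fastforce
    then show thesis using spos by (intro that[of "s * D (Suc r) y"]) auto
  qed
  \<comment> \<open>Each integration from \<open>a\<close>, where \<open>Da\<close> gives the value
    0, gains one power of \<open>x - a\<close>. The cases \<open>i = Suc r\<close> and
    \<open>i = r\<close> are the bounds for g and g'.\<close>
  have lower: "\<exists>k>0. \<forall>x\<in>{a..b}. s * D (Suc r - i) x \<ge> k * (x - a) ^ i" if "i \<le> Suc r" for i
    using that
  proof (induction i)
    case 0
    show ?case using k0 by auto
  next
    case (Suc i)
    then obtain k where k: "k > 0" "\<And>x. x \<in> {a..b} \<Longrightarrow> s * D (Suc r - i) x \<ge> k * (x - a) ^ i" by auto
    have i: "Suc r - i = Suc (r - i)" using Suc.prems by auto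
    have "s * D (r - i) x \<ge> k / (real i + 1) * (x - a) ^ Suc i" if "x \<in> {a..b}" for x
    proof (rule growth_from_deriv[where h' = "\<lambda>x. s * D (Suc r - i) x", OF _ _ k(2) that])
      show "((\<lambda>x. s * D (r - i) x) has_real_derivative s * D (Suc r - i) x) (at x within {a..b})"
        if "x \<in> {a..b}" for x unfolding i by (intro DERIV_cmult dD that)
    qed (simp add: Da)
    then show ?case using k(1) by (intro exI[of _ "k / (real i + 1)"]) auto
  qed
  obtain k1 where k1: "k1 > 0" "\<And>x. x \<in> {a..b} \<Longrightarrow> s * D 0 x \<ge> k1 * (x - a) ^ (r + 1)"
    using lower[of "Suc r"] by auto
  obtain k2 where k2: "k2 > 0" "\<And>x. x \<in> {a..b} \<Longrightarrow> s * D 1 x \<ge> k2 * (x - a) ^ r"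
    using lower[of r] by auto

  \<comment> \<open>Factoring the zero out of g and g'\<close>
  define \<gamma> where "\<gamma> x = s * g x" for x
  define G where "G x = s * (inverse (x - a) ^ (r + 1) * g x)" for x
  define G1 where "G1 x = s * (inverse (x - a) ^ r * D 1 x)" for x
  have lim0: "((vd ^^ j) g \<longlongrightarrow> 0) (at_right a)" if "j < r + 1" for j
  proof -
    have "(D j \<longlongrightarrow> 0) (at_right a)"
      using smooth_on_limit[OF ab g_smooth, of j] Da[of j] that by (simp add: D_def)
    moreover have "\<forall>\<^sub>F x in at_right a. D j x = (vd ^^ j) g x"
      by (rule eventually_at_rightI[OF _ ab]) (use vdD in auto)
    ultimately show ?thesis by (rule Lim_transform_eventually)
  qed
  have bg: "bsmooth g" using bD[of 0] D0 by simp
  have bG: "bsmooth G"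
  proof -
    obtain C where "\<forall>x\<in>I. norm (g x) \<le> C * (x - a) ^ (r + 1)"
      using bsmooth_taylor_bound[OF bg lim0] by blast
    then have "bsmooth (\<lambda>x. inverse (of_real (x - a)) ^ (r + 1) * g x)"
      by (intro bsmooth_div_power[OF bg]) auto
    from bsmooth_mult[OF bsmooth_const[of s] this] show ?thesis
      unfolding G_def[abs_def] by (simp only: of_real_eq_id id_apply)
  qed
  have bG1: "bsmooth G1"
  proof -
    have "((vd ^^ j) (vd g) \<longlongrightarrow> 0) (at_right a)" if "j < r" for j
      using lim0[of "Suc j"] that by (simp add: funpow_swap1)
    then obtain C where "\<forall>x\<in>I. norm (vd g x) \<le> C * (x - a) ^ r"
      using bsmooth_taylor_bound[OF bsmooth_vd[OF bg]] by blast
    then have "bsmooth (\<lambda>x. inverse (of_real (x - a)) ^ r * D 1 x)"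
      using vdD[of _ 1] by (intro bsmooth_div_power[OF bD]) auto
    from bsmooth_mult[OF bsmooth_const[of s] this] show ?thesis
      unfolding G1_def[abs_def] by (simp only: of_real_eq_id id_apply)
  qed
  have canc: "(x - a) ^ j * (t * (inverse (x - a) ^ j * y)) = t * y" if "x \<in> I" for x t y :: real and j
  proof -
    have "(x - a) ^ j * (t * (inverse (x - a) ^ j * y)) = ((x - a) * inverse (x - a)) ^ j * (t * y)"
      by (simp only: power_mult_distrib mult_ac)
    then show ?thesis using that by simp
  qed
  have eG: "(x - a) ^ (r + 1) * G x = s * g x" if "x \<in> I" for x
    unfolding G_def by (rule canc[OF that])
  have eG1: "(x - a) ^ r * G1 x = s * D 1 x" if "x \<in> I" for x
    unfolding G1_def by (rule canc[OF that])
  interpret phase a b r \<gamma> G G1 "min k1 k2"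
  proof
    fix x assume x: "x \<in> I"
    then have p: "(x - a) ^ j > 0" for j by simp
    show "\<gamma> x = (x - a) ^ (r + 1) * G x"
      unfolding \<gamma>_def eG[OF x] ..
    have "(g has_real_derivative D 1 x) (at x within {a..b})" using dD[of x 0] x by (simp add: D0)
    then have "(g has_real_derivative D 1 x) (at x within I)" by (rule DERIV_subset) auto
    then show "(\<gamma> has_real_derivative (x - a) ^ r * G1 x) (at x within I)"
      unfolding eG1[OF x] \<gamma>_def[abs_def] by (rule DERIV_cmult)
    have "k1 * (x - a) ^ (r + 1) \<le> G x * (x - a) ^ (r + 1)"
      using k1(2)[of x] x unfolding mult.commute[of "G x"] eG[OF x] D0 by simp
    then have "k1 \<le> G x" using p[of "r + 1"] by (rule mult_right_le_imp_le)
    then show "min k1 k2 \<le> G x" by simp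
    have "k2 * (x - a) ^ r \<le> G1 x * (x - a) ^ r"
      using k2(2)[of x] x unfolding mult.commute[of "G1 x"] eG1[OF x] by simp
    then have "k2 \<le> G1 x" using p[of r] by (rule mult_right_le_imp_le)
    then show "min k1 k2 \<le> G1 x" by simp
  qed (use r bG bG1 k1 k2 in auto)

  \<comment> \<open>The interpolation error and its zeros\<close>
  define p where "p = (\<lambda>y. \<Sum>i<n. c i * phihat r a b g i y)"
  \<comment> \<open>The exponent (i-r)/(r+1) turns (x-a)^(r+1) into (x-a)^(i-r), and g' supplies the
    missing (x-a)^r. Only \<open>G\<close>, which is bounded below, retains a fractional
    power.\<close>
  have phi: "phihat r a b g i x = s * ((x - a) ^ i * (G1 x * G x powr ((real i - real r) / (real r + 1))))"
    if x: "x \<in> I" for i x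
  proof -
    let ?q = "(real i - real r) / (real r + 1)"
    have "phihat r a b g i x = D 1 x * \<gamma> x powr ?q"
      by (simp add: phihat_def s_def \<gamma>_def D_def del: nderiv.simps)
    also have "D 1 x = s * ((x - a) ^ r * G1 x)"
      unfolding eG1[OF x] mult.assoc[symmetric] ss by simp
    also have "\<gamma> x powr ?q = (x - a) powr (real i - real r) * G x powr ?q"
    proof -
      have "(x - a) ^ (r + 1) = (x - a) powr (real r + 1)"
        using x powr_realpow[of "x - a" "r + 1"] by (simp add: add.commute)
      then show ?thesis unfolding gam[OF x] using x G_pos[OF x] by (simp add: powr_mult powr_powr)
    qed
    also have "(x - a) powr (real i - real r) = (x - a) ^ i / (x - a) ^ r"
      using x by (simp add: powr_diff powr_realpow)
    finally show ?thesis using x by simp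
  qed
  have bp: "bsmooth p"
  proof -
    have "bsmooth (\<lambda>x. \<Sum>i<n. c i * (s * ((x - a) ^ i * (G1 x * G x powr ((real i - real r) / (real r + 1))))))"
      by (intro bsmooth_sum bsmooth_mult bsmooth_const bsmooth_power bsmooth_diff bsmooth_ident bG1
          bsmooth_powr[OF _ Gc bG]) (use k1 k2 in auto)
    then show ?thesis by (subst bsmooth_cong) (auto simp: p_def phi)
  qed
  have bf: "bsmooth f" using smooth_on_bsmooth[OF f_smooth, of 0] by simp
  define h where "h x = f x - p x" for x
  have bh: "bsmooth h" unfolding h_def[abs_def] by (rule bsmooth_diff[OF bf bp])
  have vdh: "(vd ^^ j) h x = nderiv j {a..b} f x - nderiv j I p x" if "x \<in> I" for j x
    unfolding h_def[abs_def] vd_funpow_diff[OF bf bp that] vd_nderiv[OF f_smooth that] nderiv_I[OF bp that] ..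
  have "((vd ^^ j) h \<longlongrightarrow> 0) (at_right a)" if "j < m * (r + 1)" for j
  proof -
    have "((\<lambda>x. nderiv j {a..b} f x - nderiv j I p x) \<longlongrightarrow> nderiv j {a..b} f a - nderiv j {a..b} f a) (at_right a)"
      unfolding p_def by (intro tendsto_diff smooth_on_limit[OF ab f_smooth] interp_a) (use that m_0 in simp)
    moreover have "\<forall>\<^sub>F x in at_right a. nderiv j {a..b} f x - nderiv j I p x = (vd ^^ j) h x"
      by (rule eventually_at_rightI[OF _ ab]) (use vdh in auto)
    ultimately show ?thesis using Lim_transform_eventually by fastforce
  qed
  from bsmooth_taylor_bound[OF bh this]
  obtain C where C: "\<forall>x\<in>I. norm (h x) \<le> C * (x - a) ^ (m * (r + 1))" by blast
  define S where "S x = inverse (of_real (x - a)) ^ (m * (r + 1)) * h x" for x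
  have bS: "bsmooth S" unfolding S_def[abs_def] by (rule bsmooth_div_power[OF bh]) (use C in auto)
  have hS: "h x = S x * (x - a) ^ (m * (r + 1))" if "x \<in> I" for x
    using canc[OF that, of "m * (r + 1)" 1 "h x"]
    unfolding S_def of_real_eq_id id_apply mult_1 by (simp only: mult.commute)
  \<comment> \<open>The last node differs from \<open>a\<close>, so \<open>interp\<close>, which
    starts at index 1, covers it and gives the zero of order \<open>m\<close> at
    \<open>b\<close>.\<close>
  have "d \<noteq> 0" using nodes0 nodesd ab by (metis less_irrefl)
  then have "flat m h" unfolding flat_def
    using interp[of d] m_d nodesd vdh[OF b_in_I] by (auto simp: p_def)
  then have "flat m (\<lambda>x. S x * (x - a) ^ (m * (r + 1)))" by (rule flat_cong[rotated]) (rule hS)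
  then have "flat m S"
    by (rule flat_cancel[rotated 3]) (use ab bS in \<open>auto intro!: bsmooth_power bsmooth_diff bsmooth_ident bsmooth_const\<close>)
  then have fS: "flat m (\<lambda>x. complex_of_real (S x))" by (rule flat_of_real[OF bS])

  \<comment> \<open>The integral of the error\<close>
  have nu': "(real r + 1) * Re \<nu> > - 1" using nu by (simp add: field_simps)
  obtain K where K: "\<And>\<omega>. \<omega> > 0 \<Longrightarrow> \<omega> * (b - a) ^ (r + 1) \<ge> 1 \<Longrightarrow>
    norm (integral {a..b} (\<lambda>x. of_real ((x - a) powr (real m * (real r + 1))) * complex_of_real (S x) * J \<nu> \<omega> x))
      \<le> K * \<omega> powr (- (real m + 1 / (real r + 1)))"
    using J_integral_decay[OF bsmooth_of_real[OF bS] fS nu'] by blast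
  \<comment> \<open>For a negative g, passing from g to |g| inside the Bessel function multiplies it
    by this factor, which depends neither on x nor on \<omega>.\<close>
  define \<kappa> where "\<kappa> = (if s = 1 then 1 else exp (\<i> * pi * \<nu>))"
  have Jg: "besselJ \<nu> (complex_of_real (\<omega> * g x)) = \<kappa> * J \<nu> \<omega> x" if "x \<in> {a..b}" "\<omega> > 0" for x \<omega>
  proof (cases "s = 1")
    case True
    then show ?thesis by (simp add: \<kappa>_def J_def \<gamma>_def)
  next
    case False
    then have s: "s = - 1" by (simp add: s_def split: if_splits)
    have "\<gamma> x \<ge> 0" using gam_pos[of x] that g_a by (cases "x = a") (auto simp: \<gamma>_def)
    then have "\<omega> * \<gamma> x \<ge> 0" using that by simp
    from besselJ_minus[OF this, of \<nu>] show ?thesis by (simp add: \<kappa>_def J_def \<gamma>_def s)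
  qed
  have bi: "bessel_int \<nu> a b g u \<omega> = \<kappa> * integral {a..b} (\<lambda>x. complex_of_real (u x) * J \<nu> \<omega> x)"
    if "\<omega> > 0" for u \<omega>
  proof -
    have "bessel_int \<nu> a b g u \<omega> = integral {a..b} (\<lambda>x. \<kappa> * (complex_of_real (u x) * J \<nu> \<omega> x))"
      unfolding bessel_int_def by (rule integral_cong) (simp only: Jg that mult.left_commute)
    then show ?thesis by simp
  qed
  have diff: "bessel_int \<nu> a b g f \<omega> - bessel_int \<nu> a b g p \<omega>
    = \<kappa> * integral {a..b} (\<lambda>x. of_real ((x - a) powr (real m * (real r + 1))) * complex_of_real (S x) * J \<nu> \<omega> x)"
    if w: "\<omega> > 0" for \<omega>
  proof -
    have "integral {a..b} (\<lambda>x. complex_of_real (f x) * J \<nu> \<omega> x) - integral {a..b} (\<lambda>x. complex_of_real (p x) * J \<nu> \<omega> x)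
      = integral {a..b} (\<lambda>x. complex_of_real (f x) * J \<nu> \<omega> x - complex_of_real (p x) * J \<nu> \<omega> x)"
      by (intro integral_diff[symmetric] bsmooth_J_integrable bsmooth_of_real bf bp w nu')
    also have "\<dots> = integral {a..b} (\<lambda>x. of_real ((x - a) powr (real m * (real r + 1))) * complex_of_real (S x) * J \<nu> \<omega> x)"
    \<comment> \<open>At \<open>a\<close> the interpolant takes the conventional value 0, so the
      factorisation of the error is available only on (a, b].\<close>
    proof (rule integral_spike[of "{a}"])
      fix x assume "x \<in> {a..b} - {a}"
      then have x: "x \<in> I" by auto
      have "(x - a) powr (real m * (real r + 1)) = (x - a) ^ (m * (r + 1))"
        using x powr_realpow[of "x - a" "m * (r + 1)"] by (simp add: algebra_simps)
      then have "complex_of_real (f x) - complex_of_real (p x)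
         = of_real ((x - a) powr (real m * (real r + 1))) * complex_of_real (S x)"
        using hS[OF x] unfolding h_def by (metis mult.commute of_real_diff of_real_mult)
      then show "of_real ((x - a) powr (real m * (real r + 1))) * complex_of_real (S x) * J \<nu> \<omega> x
        = complex_of_real (f x) * J \<nu> \<omega> x - complex_of_real (p x) * J \<nu> \<omega> x"
        by (simp only: left_diff_distrib[symmetric])
    qed simp
    finally show ?thesis unfolding bi[OF w] right_diff_distrib[symmetric] by simp
  qed
  show ?thesis unfolding p_def[symmetric]
  proof (rule bigoI)
    \<comment> \<open>Beyond this frequency the splitting scale \<delta> is at most
      \<open>b - a\<close>, as the decay estimate requires.\<close>
    have "\<forall>\<^sub>F \<omega> in at_top. \<omega> \<ge> max 1 (1 / (b - a) ^ (r + 1))" by (rule eventually_ge_at_top)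
    then show "\<forall>\<^sub>F \<omega> in at_top. norm (bessel_int \<nu> a b g f \<omega> - bessel_int \<nu> a b g p \<omega>)
      \<le> norm \<kappa> * K * norm (complex_of_real (\<omega> powr (- (real m + 1 / (real r + 1)))))"
    proof eventually_elim
      case (elim \<omega>)
      then have w: "\<omega> > 0" by simp
      have "(b - a) ^ (r + 1) > 0" using ab by simp
      then have "\<omega> * (b - a) ^ (r + 1) \<ge> 1" using elim by (simp add: divide_le_eq)
      from mult_left_mono[OF K[OF w this] norm_ge_zero[of \<kappa>]]
      show ?case unfolding diff[OF w] norm_mult norm_of_real by (simp add: mult.assoc)
    qed
  qed
qed

end
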